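(* Suppose the standing assumptions on (P) listed in the context hold and $G$ is strongly convex with modulus $\beta_G>0$. Let $\{(u^k,p^k)\}$ be generated by VAPP-S with $\eta=\frac{\beta_G}{2\tau^2}$ and $$\rho^k=(k+1)\eta,\qquad \epsilon^k=\frac1{(k+1)\eta\tau^2+B_G+B_\Omega+\beta_G},$$ and let $(u^*,p^* )$ be a saddle point of $L$ over $\mathbf U\times\mathbf C^*$. Let $c_0=\frac{2(B_G+B_\Omega)}{\beta_G}+2$, $a^k=(c_0+k)\big[\frac1{2\epsilon^k}-\frac{\beta_G}2\big]$, $b^k=\frac{c_0+k}{2\rho^k}$, and $$\bar u_t=\frac{\sum_{k=0}^t(c_0+k)u^{k+1}}{\sum_{k=0}^t(c_0+k)},\qquad\bar p_t=\frac{\sum_{k=0}^t(c_0+k)\tilde q^k}{\sum_{k=0}^t(c_0+k)}.$$ Then: (i) $\|u^*-u^t\|^2=o(1/t^2)$ as $t\to\infty$; (ii) for every integer $t\ge0$ and all $(u,p)\in\mathbf U\times\mathbf C^*$, $$L(\bar u_t,p)-L(u,\bar p_t)\le\frac{2a^0\|u-u^0\|^2+2b^0\|p-p^0\|^2}{(t+1)(t+2c_0)};$$ (iii) $\|\Pi(\Theta(\bar u_t))\|\le O(1/t^2)$, i.e. there is a constant $c>0$ independent of $t$ with $\|\Pi(\Theta(\bar u_t))\|\le c/t^2$ for all $t\ge1$; (iv) $-O(1/t^2)\le(G+J)(\bar u_t)-(G+J)(u^* )\le O(1/t^2)$, i.e. there is a constant $c>0$ independent of $t$ with $|(G+J)(\bar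 u_t)-(G+J)(u^* )|\le c/t^2$ for all $t\ge1$.
   Context: Norms are Euclidean. $\mathbf U\subset\mathbb R^n$ is a nonempty closed convex set; $\mathbf C\subset\mathbb R^m$ is a nonempty closed convex cone with vertex at the origin; $\mathbf C^*=\{y:\langle y,x\rangle\ge0\ \forall x\in\mathbf C\}$; $\Pi$ is the Euclidean projection onto $\mathbf C^*$. Problem (P): minimize $G(u)+J(u)$ subject to $\Theta(u)=\Omega(u)+\Phi(u)\in-\mathbf C$, $u\in\mathbf U$, where $\Omega,\Phi$ map into $\mathbb R^m$. Lagrangian: $L(u,p)=(G+J)(u)+\langle p,\Theta(u)\rangle$. A saddle point of $L$ over $\mathbf U\times\mathbf C^*$ is $(u^*,p^* )\in\mathbf U\times\mathbf C^*$ with $L(u^*,p)\le L(u^*,p^* )\le L(u,p^* )$ for all $u\in\mathbf U,p\in\mathbf C^*$. Standing assumptions on (P): (H1) $J$ is a convex l.s.c. function (not necessarily differentiable) with $\operatorname{dom}J\cap\mathbf U\ne\emptyset$. (H2) $G$ is convex and differentiable, with derivative Lipschitz with constant $B_G$. (H3) $\Omega$ and $\Phi$ are $\mathbf C$-convex on $\mathbf U$, where $F$ is $\mathbf C$-convex if $F(\alpha u+(1-\alpha)v)-\alpha F(u)-(1-\alpha)F(v)\in-\mathbf C$ for all $u,v\in\mathbf U$, $\alpha\in[0,1]$. (H4) $\Omega$ is differentiable and for every $p\in\mathbb R^m$ the function $f_p(u)=\langle p,\Omega(u)\rangle$ satisfies $\|\nabla f_p(u)-\nabla f_p(v)\|\le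 B_\Omega\|u-v\|$ for all $u,v\in\mathbf U$, with $B_\Omega$ independent of $p$. (H5) $\Theta$ is Lipschitz with constant $\tau$ (here $\tau>0$) on an open set containing $\mathbf U$. (H6) If the interior $\mathring{\mathbf C}\neq\emptyset$, then $\Theta(\mathbf U)\cap(-\mathring{\mathbf C})\ne\emptyset$; if $\mathbf C=\{0\}$, then $0$ is in the interior of $\Theta(\mathbf U)$. (H7) $L$ has at least one saddle point over $\mathbf U\times\mathbf C^*$. VAPP-S (core function $K(u)=\frac12\|u\|^2$): fix $u^0\in\mathbf U$, $p^0\in\mathbf C^*$. For $k=0,1,\dots$, with $\tilde q^k=\Pi(p^k+\rho^k\Theta(u^k))$, set $$u^{k+1}=\arg\min_{u\in\mathbf U}\langle\nabla G(u^k),u\rangle+J(u)+\langle\tilde q^k,\nabla\Omega(u^k)u+\Phi(u)\rangle+\frac{\|u-u^k\|^2}{2\epsilon^k},\qquad p^{k+1}=\Pi(p^k+\rho^k\Theta(u^{k+1})).$$ *)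

theory Defs
  imports "HOL-Analysis.Analysis" "HOL-Library.Landau_Symbols"
begin

definition dual_cone :: "'a::real_inner set \<Rightarrow> 'a set" where
  "dual_cone C = {y. \<forall>x\<in>C. y \<bullet> x \<ge> 0}"

definition gradient :: "('a::real_inner \<Rightarrow> real) \<Rightarrow> 'a \<Rightarrow> 'a" where
  "gradient f x = (THE D. GDERIV f x :> D)"

lemma GDERIV_gradient:
  fixes f :: "'a::euclidean_space \<Rightarrow> real"
  assumes "f differentiable (at x)"
  shows "GDERIV f x :> gradient f x"
proof -
  obtain f' where f': "(f has_derivative f') (at x)"
    using assms by (auto simp: differentiable_def)
  have lin: "linear f'"
    using f' by (rule has_derivative_linear)
  define D where "D = (\<Sum>b\<in>Basis. f' b *\<^sub>R b)"
  have "f' h = h \<bullet> D" for h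
  proof -
    have "f' h = f' (\<Sum>b\<in>Basis. (h \<bullet> b) *\<^sub>R b)"
      by (simp add: euclidean_representation)
    also have "\<dots> = (\<Sum>b\<in>Basis. (h \<bullet> b) * f' b)"
      using lin by (simp add: linear_sum linear_scale)
    finally show ?thesis
      by (simp add: D_def inner_sum_right mult.commute)
  qed
  then have "f' = (\<lambda>h. h \<bullet> D)" ..
  with f' have D: "GDERIV f x :> D"
    by (simp add: gderiv_def)
  have "E = D" if "GDERIV f x :> E" for E
  proof -
    have "(\<lambda>h. h \<bullet> E) = (\<lambda>h. h \<bullet> D)"
      using that D unfolding gderiv_def by (rule has_derivative_unique)
    then have "\<forall>h. h \<bullet> E = h \<bullet> D" by metis
    then show ?thesis by (metis inner_commute vector_eq_rdot)
  qed
  with D show ?thesis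
    unfolding gradient_def by (metis theI)
qed

text \<open>Extended-valued functions; used only for functions that never take the value
  \<^term>\<open>-\<infinity>\<close>, so that the right-hand side is never of the form \<open>\<infinity> - \<infinity>\<close>.\<close>

definition ereal_convex :: "('a::real_vector \<Rightarrow> ereal) \<Rightarrow> bool" where
  "ereal_convex f \<longleftrightarrow> (\<forall>x y. \<forall>\<alpha>\<in>{0..1}.
     f (\<alpha> *\<^sub>R x + (1 - \<alpha>) *\<^sub>R y) \<le> ereal \<alpha> * f x + ereal (1 - \<alpha>) * f y)"

definition lsc :: "('a::topological_space \<Rightarrow> ereal) \<Rightarrow> bool" where
  "lsc f \<longleftrightarrow> (\<forall>x. f x \<le> Liminf (at x) f)"

definition effective_domain :: "('a \<Rightarrow> ereal) \<Rightarrow> 'a set" where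
  "effective_domain f = {x. f x < \<infinity>}"

definition strongly_convex :: "('a::real_normed_vector \<Rightarrow> real) \<Rightarrow> real \<Rightarrow> bool" where
  "strongly_convex f \<beta> \<longleftrightarrow> (\<forall>x y. \<forall>\<alpha>\<in>{0..1}.
     f (\<alpha> *\<^sub>R x + (1 - \<alpha>) *\<^sub>R y)
       \<le> \<alpha> * f x + (1 - \<alpha>) * f y - \<beta> / 2 * \<alpha> * (1 - \<alpha>) * (norm (x - y))\<^sup>2)"

definition cone_convex_on ::
  "'b::real_vector set \<Rightarrow> 'a::real_vector set \<Rightarrow> ('a \<Rightarrow> 'b) \<Rightarrow> bool" where
  "cone_convex_on C U F \<longleftrightarrow> (\<forall>u\<in>U. \<forall>v\<in>U. \<forall>\<alpha>\<in>{0..1}.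
     F (\<alpha> *\<^sub>R u + (1 - \<alpha>) *\<^sub>R v) - \<alpha> *\<^sub>R F u - (1 - \<alpha>) *\<^sub>R F v \<in> uminus ` C)"

definition objective :: "('a \<Rightarrow> real) \<Rightarrow> ('a \<Rightarrow> ereal) \<Rightarrow> 'a \<Rightarrow> ereal" where
  "objective G J u = ereal (G u) + J u"

definition lagrangian ::
  "('a \<Rightarrow> real) \<Rightarrow> ('a \<Rightarrow> ereal) \<Rightarrow> ('a \<Rightarrow> 'b::real_inner) \<Rightarrow> 'a \<Rightarrow> 'b \<Rightarrow> ereal" where
  "lagrangian G J \<Theta> u p = objective G J u + ereal (p \<bullet> \<Theta> u)"

definition saddle_point :: "('a \<Rightarrow> 'b \<Rightarrow> ereal) \<Rightarrow> 'a set \<Rightarrow> 'b set \<Rightarrow> 'a \<Rightarrow> 'b \<Rightarrow> bool" where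
  "saddle_point L U P us ps \<longleftrightarrow> us \<in> U \<and> ps \<in> P \<and>
     (\<forall>u\<in>U. \<forall>p\<in>P. L us p \<le> L us ps \<and> L us ps \<le> L u ps)"

definition vapp_s ::
  "'a::euclidean_space set \<Rightarrow> 'b::euclidean_space set \<Rightarrow> ('a \<Rightarrow> real) \<Rightarrow> ('a \<Rightarrow> ereal) \<Rightarrow>
   ('a \<Rightarrow> 'b) \<Rightarrow> ('a \<Rightarrow> 'b) \<Rightarrow> (nat \<Rightarrow> real) \<Rightarrow> (nat \<Rightarrow> real) \<Rightarrow>
   (nat \<Rightarrow> 'a) \<Rightarrow> (nat \<Rightarrow> 'b) \<Rightarrow> (nat \<Rightarrow> 'b) \<Rightarrow> bool" where
  "vapp_s U C G J \<Omega> \<Phi> \<rho> \<epsilon> u p q \<longleftrightarrow>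
     u 0 \<in> U \<and> p 0 \<in> dual_cone C \<and>
     (\<forall>k. q k = closest_point (dual_cone C) (p k + \<rho> k *\<^sub>R (\<Omega> (u k) + \<Phi> (u k))) \<and>
          is_arg_min
            (\<lambda>v. ereal (gradient G (u k) \<bullet> v) + J v
                 + ereal (q k \<bullet> (frechet_derivative \<Omega> (at (u k)) v + \<Phi> v))
                 + ereal ((norm (v - u k))\<^sup>2 / (2 * \<epsilon> k)))
            (\<lambda>v. v \<in> U) (u (Suc k)) \<and>
          p (Suc k) = closest_point (dual_cone C)
            (p k + \<rho> k *\<^sub>R (\<Omega> (u (Suc k)) + \<Phi> (u (Suc k)))))"

end

theory Submission
  imports Defs
begin

text \<open>
  With \<open>1 / \<epsilon>\<^sub>k = \<beta>\<^sub>G / 2 * (c0 + k + 1)\<close> and \<open>\<rho>\<^sub>k = (k + 1) \<eta>\<close>, one step of the method satisfies, for every \<open>v\<close>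
  in \<open>U \<inter> dom J\<close> and every \<open>r\<close> in the dual cone,
  \<open>L(u\<^sub>k\<^sub>+\<^sub>1, r) - L(v, q\<^sub>k) \<le> \<beta>\<^sub>G/4 (c0 + k - 1) |v - u\<^sub>k|\<^sup>2 - \<beta>\<^sub>G/4 (c0 + k + 1) |v - u\<^sub>k\<^sub>+\<^sub>1|\<^sup>2
  + (|r - p\<^sub>k|\<^sup>2 - |r - p\<^sub>k\<^sub>+\<^sub>1|\<^sup>2 - |q\<^sub>k - p\<^sub>k|\<^sup>2) / (2 \<rho>\<^sub>k) - \<beta>\<^sub>G/2 |u\<^sub>k\<^sub>+\<^sub>1 - u\<^sub>k|\<^sup>2\<close>.
  The primal half combines the optimality of \<open>u\<^sub>k\<^sub>+\<^sub>1\<close> for a \<open>1 / \<epsilon>\<^sub>k\<close>-strongly convex subproblem with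
  the two-sided first-order bounds on \<open>G\<close> and \<open>\<langle>q\<^sub>k, \<Omega>\<rangle>\<close>; the dual half is the extragradient argument for two
  projections from the same base point (lemma \<open>linearized_primal_dual_step\<close>).

  Multiplied by the weight \<open>c0 + k\<close>, the primal coefficient left at the end of step \<open>k\<close> is
  \<open>\<beta>\<^sub>G/4 (c0 + k) (c0 + k + 1)\<close>, exactly the one needed at the start of step \<open>k + 1\<close>, while the dual
  coefficients \<open>(c0 + k) / (2 \<rho>\<^sub>k)\<close> decrease. So the weighted inequalities telescope through an energy
  \<open>a\<^sub>k |v - u\<^sub>k|\<^sup>2 + b\<^sub>k |r - p\<^sub>k|\<^sup>2\<close>, and since the weights add up to \<open>(t + 1) (t + 2 c0) / 2\<close>,
  convexity of the Lagrangian in \<open>u\<close> and its affine dependence on \<open>p\<close> give the gap bound at the averaged iterates.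
  Evaluating that bound at \<open>p\<^sup>* + \<Pi>(\<Theta>)/|\<Pi>(\<Theta>)|\<close> and at \<open>0\<close> gives the bounds on infeasibility and on the
  objective.

  The rate \<open>o(1/t\<^sup>2)\<close> for \<open>|u\<^sup>* - u\<^sub>t|\<^sup>2\<close> needs more than the bounded energy, because the energy
  might stay in its dual part or move back and forth. Strong convexity of the Lagrangian at \<open>u\<^sup>*\<close> makes
  \<open>\<Sum> k (|u\<^sub>k\<^sub>+\<^sub>1 - u\<^sup>*|\<^sup>2 + |u\<^sub>k\<^sub>+\<^sub>1 - u\<^sub>k|\<^sup>2)\<close> finite, so along a subsequence
  \<open>k\<^sup>2 (|u\<^sub>k\<^sub>+\<^sub>1 - u\<^sup>*|\<^sup>2 + |u\<^sub>k\<^sub>+\<^sub>1 - u\<^sub>k|\<^sup>2)\<close> tends to \<open>0\<close>. Along it the one-step inequality passes to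
  the limit, so every cluster point \<open>r\<close> of the multipliers there is again a saddle multiplier for \<open>u\<^sup>*\<close>.
  The energy relative to this new saddle point \<open>(u\<^sup>*, r)\<close> is decreasing and tends to \<open>0\<close> along a
  further subsequence on which the multipliers converge to \<open>r\<close>; hence it tends to \<open>0\<close>, and with it \<open>t\<^sup>2 |u\<^sup>* - u\<^sub>t|\<^sup>2\<close> (lemmas \<open>saddle_of_limit\<close> and
  \<open>energy_tendsto_0\<close>).
\<close>

section \<open>Strong convexity and first-order bounds\<close>

text \<open>The notion is relative to a set because the objective is finite only on the domain of \<open>J\<close> and
  \<open>\<langle>q, \<Omega>\<rangle>\<close> is convex only on \<open>U\<close>; modulus \<open>0\<close> is plain convexity, so that one gradient inequality serves
  both \<open>G\<close> and \<open>\<langle>q, \<Omega>\<rangle>\<close>.\<close>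

definition strongly_convex_on ::
  "'a::real_normed_vector set \<Rightarrow> ('a \<Rightarrow> real) \<Rightarrow> real \<Rightarrow> bool" where
  "strongly_convex_on S f m \<longleftrightarrow> (\<forall>x\<in>S. \<forall>y\<in>S. \<forall>\<alpha>\<in>{0..1}.
     f (\<alpha> *\<^sub>R x + (1 - \<alpha>) *\<^sub>R y)
       \<le> \<alpha> * f x + (1 - \<alpha>) * f y - m / 2 * \<alpha> * (1 - \<alpha>) * (norm (x - y))\<^sup>2)"

lemma convex_on_imp_strongly_convex_on_0:
  assumes "convex_on S f"
  shows "strongly_convex_on S f 0"
  unfolding strongly_convex_on_def
proof (intro ballI)
  fix x y \<alpha> assume "x \<in> S" "y \<in> S" "\<alpha> \<in> {0..1::real}"
  then show "f (\<alpha> *\<^sub>R x + (1 - \<alpha>) *\<^sub>R y)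
      \<le> \<alpha> * f x + (1 - \<alpha>) * f y - 0 / 2 * \<alpha> * (1 - \<alpha>) * (norm (x - y))\<^sup>2"
    using convex_onD[OF assms, of "1 - \<alpha>" x y] by simp
qed

lemma strongly_convex_on_imp_convex_on:
  assumes "strongly_convex_on S f m" "0 \<le> m" "convex S"
  shows "convex_on S f"
proof (rule convex_onI)
  fix t x y assume t: "0 < t" "t < (1::real)" and xy: "x \<in> S" "y \<in> S"
  have "f ((1 - t) *\<^sub>R x + (1 - (1 - t)) *\<^sub>R y)
      \<le> (1 - t) * f x + (1 - (1 - t)) * f y - m / 2 * (1 - t) * (1 - (1 - t)) * (norm (x - y))\<^sup>2"
    by (rule assms(1)[unfolded strongly_convex_on_def, rule_format]) (use xy t in auto)
  moreover have "0 \<le> m / 2 * (1 - t) * (1 - (1 - t)) * (norm (x - y))\<^sup>2"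
    using assms(2) t by simp
  ultimately show "f ((1 - t) *\<^sub>R x + t *\<^sub>R y) \<le> (1 - t) * f x + t * f y"
    by simp
qed (use assms in auto)

lemma strongly_convex_on_add:
  assumes "strongly_convex_on S f m" "strongly_convex_on S g n"
  shows "strongly_convex_on S (\<lambda>x. f x + g x) (m + n)"
  unfolding strongly_convex_on_def
proof (intro ballI)
  fix x y \<alpha> assume *: "x \<in> S" "y \<in> S" "\<alpha> \<in> {0..1::real}"
  have "f (\<alpha> *\<^sub>R x + (1 - \<alpha>) *\<^sub>R y)
      \<le> \<alpha> * f x + (1 - \<alpha>) * f y - m / 2 * \<alpha> * (1 - \<alpha>) * (norm (x - y))\<^sup>2"
    using assms(1) * unfolding strongly_convex_on_def by blast
  moreover have "g (\<alpha> *\<^sub>R x + (1 - \<alpha>) *\<^sub>R y)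
      \<le> \<alpha> * g x + (1 - \<alpha>) * g y - n / 2 * \<alpha> * (1 - \<alpha>) * (norm (x - y))\<^sup>2"
    using assms(2) * unfolding strongly_convex_on_def by blast
  ultimately show "f (\<alpha> *\<^sub>R x + (1 - \<alpha>) *\<^sub>R y) + g (\<alpha> *\<^sub>R x + (1 - \<alpha>) *\<^sub>R y)
      \<le> \<alpha> * (f x + g x) + (1 - \<alpha>) * (f y + g y)
        - (m + n) / 2 * \<alpha> * (1 - \<alpha>) * (norm (x - y))\<^sup>2"
    by (simp add: algebra_simps add_divide_distrib)
qed

lemma strongly_convex_on_dist_sq:
  fixes z :: "'a::real_inner"
  shows "strongly_convex_on S (\<lambda>x. (norm (x - z))\<^sup>2 / (2 * e)) (1 / e)"
  unfolding strongly_convex_on_def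
proof (intro ballI)
  fix x y :: 'a and \<alpha> :: real
  have "(norm (\<alpha> *\<^sub>R x + (1 - \<alpha>) *\<^sub>R y - z))\<^sup>2 =
      \<alpha> * (norm (x - z))\<^sup>2 + (1 - \<alpha>) * (norm (y - z))\<^sup>2 - \<alpha> * (1 - \<alpha>) * (norm (x - y))\<^sup>2"
    unfolding power2_norm_eq_inner
    by (simp add: algebra_simps inner_simps inner_commute)
  then show "(norm (\<alpha> *\<^sub>R x + (1 - \<alpha>) *\<^sub>R y - z))\<^sup>2 / (2 * e)
      \<le> \<alpha> * ((norm (x - z))\<^sup>2 / (2 * e)) + (1 - \<alpha>) * ((norm (y - z))\<^sup>2 / (2 * e))
        - 1 / e / 2 * \<alpha> * (1 - \<alpha>) * (norm (x - y))\<^sup>2"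
    by (simp add: add_divide_distrib diff_divide_distrib)
qed

text \<open>Compare \<open>f\<close> along the segment from \<open>w\<close> to \<open>v\<close> with its chord: after division by \<open>t\<close>, the limit
  \<open>t \<rightarrow> 0\<close> turns the chord inequality into the tangent inequality.\<close>

lemma strongly_convex_on_gradient_inequality:
  fixes f :: "'a::real_inner \<Rightarrow> real"
  assumes f: "strongly_convex_on S f m" and S: "w \<in> S" "v \<in> S" and g: "GDERIV f w :> g"
  shows "f w + (v - w) \<bullet> g + m / 2 * (norm (v - w))\<^sup>2 \<le> f v"
proof -
  define \<phi> where "\<phi> t = f (w + t *\<^sub>R (v - w))" for t :: real
  have "((\<lambda>t. w + t *\<^sub>R (v - w)) has_derivative (\<lambda>t. t *\<^sub>R (v - w))) (at 0)"
    by (auto intro!: derivative_eq_intros)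
  moreover have "(f has_derivative (\<lambda>h. h \<bullet> g)) (at (w + 0 *\<^sub>R (v - w)))"
    using g by (simp add: gderiv_def)
  ultimately have "(\<phi> has_derivative (\<lambda>t. (t *\<^sub>R (v - w)) \<bullet> g)) (at 0)"
    unfolding \<phi>_def by (rule has_derivative_compose)
  then have "(\<phi> has_field_derivative ((v - w) \<bullet> g)) (at 0)"
    by (simp add: has_field_derivative_def mult.commute mult_commute_abs)
  then have lim1: "((\<lambda>t. (\<phi> (0 + t) - \<phi> 0) / t) \<longlongrightarrow> (v - w) \<bullet> g) (at_right 0)"
    unfolding DERIV_def by (rule filterlim_mono) (auto simp: at_le)
  have lim2: "((\<lambda>t. f v - f w - m / 2 * (1 - t) * (norm (v - w))\<^sup>2)
      \<longlongrightarrow> f v - f w - m / 2 * (1 - 0) * (norm (v - w))\<^sup>2) (at_right 0)"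
    by (intro tendsto_intros)
  have "\<forall>\<^sub>F t in at_right 0. t \<in> {0<..<1::real}"
    by (rule eventually_at_right_real) simp
  then have ev: "\<forall>\<^sub>F t in at_right 0.
      (\<phi> (0 + t) - \<phi> 0) / t \<le> f v - f w - m / 2 * (1 - t) * (norm (v - w))\<^sup>2"
  proof eventually_elim
    case (elim t)
    have "f (t *\<^sub>R v + (1 - t) *\<^sub>R w)
        \<le> t * f v + (1 - t) * f w - m / 2 * t * (1 - t) * (norm (v - w))\<^sup>2"
      using f S elim unfolding strongly_convex_on_def by auto
    moreover have "t *\<^sub>R v + (1 - t) *\<^sub>R w = w + t *\<^sub>R (v - w)"
      by (simp add: algebra_simps)
    ultimately have "\<phi> t - \<phi> 0 \<le> t * (f v - f w - m / 2 * (1 - t) * (norm (v - w))\<^sup>2)"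
      unfolding \<phi>_def by (simp add: algebra_simps)
    then show ?case
      using elim by (simp add: pos_divide_le_eq mult.commute)
  qed
  have "(v - w) \<bullet> g \<le> f v - f w - m / 2 * (1 - 0) * (norm (v - w))\<^sup>2"
    by (rule tendsto_le[OF _ lim2 lim1 ev]) simp
  then show ?thesis by simp
qed

text \<open>The same chord argument as for the gradient inequality, with minimality of \<open>w\<close> on the segment in place
  of a derivative. It serves non-smooth \<open>f\<close>: once for the proximal subproblem and once for the
  Lagrangian at a saddle point.\<close>

lemma strongly_convex_on_quadratic_growth:
  fixes f :: "'a::real_normed_vector \<Rightarrow> real"
  assumes f: "strongly_convex_on S f m" and S: "convex S" "w \<in> S" "v \<in> S"
    and min: "\<And>x. x \<in> S \<Longrightarrow> f w \<le> f x"
  shows "f w + m / 2 * (norm (v - w))\<^sup>2 \<le> f v"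
proof -
  have lim: "((\<lambda>t. f v - f w - m / 2 * (1 - t) * (norm (v - w))\<^sup>2)
      \<longlongrightarrow> f v - f w - m / 2 * (1 - 0) * (norm (v - w))\<^sup>2) (at_right 0)"
    by (intro tendsto_intros)
  have "\<forall>\<^sub>F t in at_right 0. t \<in> {0<..<1::real}"
    by (rule eventually_at_right_real) simp
  then have ev: "\<forall>\<^sub>F t in at_right 0. 0 \<le> f v - f w - m / 2 * (1 - t) * (norm (v - w))\<^sup>2"
  proof eventually_elim
    case (elim t)
    have "t *\<^sub>R v + (1 - t) *\<^sub>R w \<in> S"
      using S elim by (simp add: convexD)
    then have "f w \<le> f (t *\<^sub>R v + (1 - t) *\<^sub>R w)"
      by (rule min)
    also have "\<dots> \<le> t * f v + (1 - t) * f w - m / 2 * t * (1 - t) * (norm (v - w))\<^sup>2"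
      using f S elim unfolding strongly_convex_on_def by auto
    finally have "0 \<le> t * (f v - f w - m / 2 * (1 - t) * (norm (v - w))\<^sup>2)"
      by (simp add: algebra_simps)
    then show ?case
      using elim by (simp add: zero_le_mult_iff)
  qed
  have "0 \<le> f v - f w - m / 2 * (1 - 0) * (norm (v - w))\<^sup>2"
    by (rule tendsto_lowerbound[OF lim ev]) simp
  then show ?thesis by simp
qed

text \<open>The quadratic model at \<open>x\<close> dominates \<open>f\<close> because the derivative of their difference along the segment
  is nonpositive.\<close>

lemma lipschitz_gradient_upper_bound:
  fixes f :: "'a::real_inner \<Rightarrow> real"
  assumes S: "convex S" "x \<in> S" "y \<in> S"
    and g: "\<And>z. z \<in> S \<Longrightarrow> GDERIV f z :> g z" and lip: "B-lipschitz_on S g"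
  shows "f y \<le> f x + (y - x) \<bullet> g x + B / 2 * (norm (y - x))\<^sup>2"
proof -
  define z where "z t = x + t *\<^sub>R (y - x)" for t :: real
  define \<psi> where "\<psi> t = f (z t) - t * ((y - x) \<bullet> g x) - B / 2 * t\<^sup>2 * (norm (y - x))\<^sup>2" for t
  define \<psi>' where "\<psi>' t = (y - x) \<bullet> (g (z t) - g x) - B * t * (norm (y - x))\<^sup>2" for t
  have zS: "z t \<in> S" if "0 \<le> t" "t \<le> 1" for t
  proof -
    have "z t = (1 - t) *\<^sub>R x + t *\<^sub>R y"
      by (simp add: z_def algebra_simps)
    then show ?thesis using S that by (simp add: convexD)
  qed
  have der: "(\<psi> has_field_derivative \<psi>' t) (at t)" if "0 \<le> t" "t \<le> 1" for t
  proof -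
    have "(z has_derivative (\<lambda>s. s *\<^sub>R (y - x))) (at t)"
      unfolding z_def by (auto intro!: derivative_eq_intros)
    moreover have "(f has_derivative (\<lambda>h. h \<bullet> g (z t))) (at (z t))"
      using g[OF zS[OF that]] by (simp add: gderiv_def)
    ultimately have "((\<lambda>t. f (z t)) has_derivative (\<lambda>s. (s *\<^sub>R (y - x)) \<bullet> g (z t))) (at t)"
      by (rule has_derivative_compose)
    then have "((\<lambda>t. f (z t)) has_field_derivative ((y - x) \<bullet> g (z t))) (at t)"
      by (simp add: has_field_derivative_def mult.commute mult_commute_abs)
    then show ?thesis
      unfolding \<psi>_def \<psi>'_def
      by (auto intro!: derivative_eq_intros simp: inner_diff_right)
  qed
  have neg: "\<psi>' t \<le> 0" if t: "0 \<le> t" "t \<le> 1" for t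
  proof -
    have "(y - x) \<bullet> (g (z t) - g x) \<le> norm (y - x) * norm (g (z t) - g x)"
      by (rule norm_cauchy_schwarz)
    also have "\<dots> \<le> norm (y - x) * (B * norm (z t - x))"
      using lipschitz_onD[OF lip zS[OF t] S(2)] by (intro mult_left_mono) (auto simp: dist_norm)
    also have "norm (z t - x) = t * norm (y - x)"
      using t by (simp add: z_def)
    finally show ?thesis
      by (simp add: \<psi>'_def power2_eq_square algebra_simps)
  qed
  have "\<psi> 1 \<le> \<psi> 0"
  proof (rule DERIV_nonpos_imp_nonincreasing[of 0 1])
    show "\<exists>y. DERIV \<psi> t :> y \<and> y \<le> 0" if "0 \<le> t" "t \<le> 1" for t
      using der[OF that] neg[OF that] by blast
  qed simp
  then show ?thesis
    by (simp add: \<psi>_def z_def)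
qed

section \<open>Proximal and projection steps\<close>

text \<open>The proximal objective is \<open>1/e\<close>-strongly convex, so its minimizer \<open>w\<close> beats \<open>v\<close> by the margin
  \<open>|v - w|\<^sup>2 / (2 e)\<close>.\<close>

lemma proximal_step_inequality:
  fixes g z :: "'a::real_inner"
  assumes D: "convex D" "w \<in> D" "v \<in> D" and h: "convex_on D h"
    and min: "\<And>x. x \<in> D \<Longrightarrow>
      g \<bullet> w + h w + (norm (w - z))\<^sup>2 / (2 * e) \<le> g \<bullet> x + h x + (norm (x - z))\<^sup>2 / (2 * e)"
  shows "h w - h v + g \<bullet> (w - v)
    \<le> ((norm (v - z))\<^sup>2 - (norm (v - w))\<^sup>2 - (norm (w - z))\<^sup>2) / (2 * e)"
proof -
  have lin: "convex_on D (\<lambda>x. g \<bullet> x)"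
    using D(1) by (intro convex_onI) (auto simp: inner_simps)
  have "strongly_convex_on D (\<lambda>x. (g \<bullet> x + h x) + (norm (x - z))\<^sup>2 / (2 * e)) (0 + 1 / e)"
    by (intro strongly_convex_on_add convex_on_imp_strongly_convex_on_0 convex_on_add lin h
        strongly_convex_on_dist_sq)
  from strongly_convex_on_quadratic_growth[OF this D min]
  show ?thesis
    by (simp add: inner_simps diff_divide_distrib add_divide_distrib)
qed

text \<open>Here \<open>q\<close> is the predictor, computed from the old value \<open>x\<close>, and \<open>p'\<close> the corrector, computed from the
  new value \<open>y\<close>. Adding the variational inequality of \<open>p'\<close> tested at \<open>r\<close> and that of \<open>q\<close> tested at \<open>p'\<close>
  leaves the cross term \<open>\<rho> \<langle>p' - q, y - x\<rangle>\<close>, and Young's inequality absorbs its first factor into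
  \<open>|p' - q|\<^sup>2\<close>.\<close>

lemma projection_predictor_corrector:
  fixes P :: "'b::euclidean_space set"
  assumes P: "convex P" "closed P" "r \<in> P" and \<rho>: "0 < \<rho>"
    and q: "q = closest_point P (p + \<rho> *\<^sub>R x)"
    and p': "p' = closest_point P (p + \<rho> *\<^sub>R y)"
  shows "r \<bullet> y - q \<bullet> y
    \<le> ((norm (r - p))\<^sup>2 - (norm (r - p'))\<^sup>2 - (norm (q - p))\<^sup>2) / (2 * \<rho>)
      + \<rho> / 2 * (norm (y - x))\<^sup>2"
proof -
  have "p' \<in> P"
    unfolding p' using P by (intro closest_point_in_set) auto
  have 1: "(p + \<rho> *\<^sub>R y - p') \<bullet> (r - p') \<le> 0"
    unfolding p' by (rule closest_point_dot) (use P in auto)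
  have 2: "(p + \<rho> *\<^sub>R x - q) \<bullet> (p' - q) \<le> 0"
    unfolding q by (rule closest_point_dot) (use P \<open>p' \<in> P\<close> in auto)
  have 3: "0 \<le> (norm (p' - q - \<rho> *\<^sub>R (y - x)))\<^sup>2"
    by simp
  have "2 * \<rho> * (r \<bullet> y - q \<bullet> y)
    \<le> (norm (r - p))\<^sup>2 - (norm (r - p'))\<^sup>2 - (norm (q - p))\<^sup>2 + \<rho>\<^sup>2 * (norm (y - x))\<^sup>2"
    using 1 2 3 unfolding power2_norm_eq_inner
    by (simp add: inner_simps inner_commute algebra_simps power2_eq_square)
  then have "r \<bullet> y - q \<bullet> y
    \<le> ((norm (r - p))\<^sup>2 - (norm (r - p'))\<^sup>2 - (norm (q - p))\<^sup>2 + \<rho>\<^sup>2 * (norm (y - x))\<^sup>2) / (2 * \<rho>)"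
    using \<rho> by (simp add: pos_le_divide_eq mult.commute)
  then show ?thesis
    using \<rho> by (simp add: add_divide_distrib power2_eq_square)
qed

text \<open>By Moreau's decomposition, \<open>z\<close> minus its projection lies in the polar cone.\<close>

lemma closest_point_cone_inner_le:
  fixes P :: "'b::euclidean_space set"
  assumes P: "convex P" "closed P" "cone P" and r: "r \<in> P"
  shows "r \<bullet> z \<le> r \<bullet> closest_point P z"
proof -
  let ?c = "closest_point P z"
  have c: "?c \<in> P"
    using P r by (intro closest_point_in_set) auto
  have "r + ?c \<in> P"
    using P c r convex_cone by blast
  then have "(z - ?c) \<bullet> (r + ?c - ?c) \<le> 0"
    using P by (intro closest_point_dot) auto
  then show ?thesis
    by (simp add: inner_simps inner_commute)
qed

lemma closest_point_cone_inner_self: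
  fixes P :: "'b::euclidean_space set"
  assumes P: "convex P" "closed P" "cone P" "P \<noteq> {}"
  shows "closest_point P z \<bullet> z = (norm (closest_point P z))\<^sup>2"
proof -
  let ?c = "closest_point P z"
  have c: "?c \<in> P"
    using P by (intro closest_point_in_set) auto
  have "0 \<in> P"
    using P by (simp add: cone_contains_0)
  then have "(z - ?c) \<bullet> (0 - ?c) \<le> 0"
    using P by (intro closest_point_dot) auto
  then have "(norm ?c)\<^sup>2 \<le> ?c \<bullet> z"
    by (simp add: inner_simps inner_commute power2_norm_eq_inner)
  moreover have "?c \<bullet> z \<le> ?c \<bullet> ?c"
    using P c by (intro closest_point_cone_inner_le)
  ultimately show ?thesis
    by (simp add: power2_norm_eq_inner)
qed

section \<open>Dual cones and limit arguments\<close>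

lemma closed_dual_cone: "closed (dual_cone C)"
proof -
  have "dual_cone C = (\<Inter>x\<in>C. {y. 0 \<le> y \<bullet> x})"
    by (auto simp: dual_cone_def)
  then show ?thesis
    by (auto intro!: closed_INT closed_Collect_le continuous_intros)
qed

lemma convex_dual_cone: "convex (dual_cone C)"
  by (auto simp: convex_def dual_cone_def inner_simps)

lemma cone_dual_cone: "cone (dual_cone C)"
  by (auto simp: cone_def dual_cone_def)

lemma cone_convex_on_imp_convex_on_inner:
  assumes F: "cone_convex_on C U F" and U: "convex U" and r: "r \<in> dual_cone C"
  shows "convex_on U (\<lambda>v. r \<bullet> F v)"
proof (rule convex_onI)
  fix t x y assume t: "0 < t" "t < (1::real)" and xy: "x \<in> U" "y \<in> U"
  have "F ((1 - t) *\<^sub>R x + (1 - (1 - t)) *\<^sub>R y) - (1 - t) *\<^sub>R F x - (1 - (1 - t)) *\<^sub>R F y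
      \<in> uminus ` C"
    by (rule F[unfolded cone_convex_on_def, rule_format]) (use xy t in auto)
  then obtain c where c: "c \<in> C"
    "F ((1 - t) *\<^sub>R x + t *\<^sub>R y) - (1 - t) *\<^sub>R F x - t *\<^sub>R F y = - c"
    by auto
  then have "F ((1 - t) *\<^sub>R x + t *\<^sub>R y) = (1 - t) *\<^sub>R F x + t *\<^sub>R F y - c"
    by (simp add: algebra_simps)
  moreover have "0 \<le> r \<bullet> c"
    using c r by (simp add: dual_cone_def)
  ultimately show "r \<bullet> F ((1 - t) *\<^sub>R x + t *\<^sub>R y) \<le> (1 - t) * (r \<bullet> F x) + t * (r \<bullet> F y)"
    by (simp add: inner_simps)
qed (rule U)

text \<open>The definition of lower semicontinuity uses punctured neighbourhoods, whereas the sequence may visit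
  \<open>x\<close> itself; a strict lower bound at \<open>x\<close> closes that gap.\<close>

lemma lsc_le_of_tendsto:
  fixes f :: "'a::t1_space \<Rightarrow> ereal"
  assumes f: "lsc f" and X: "X \<longlonglongrightarrow> x" and c: "c \<longlonglongrightarrow> s" and le: "\<And>n. f (X n) \<le> ereal (c n)"
  shows "f x \<le> ereal s"
proof (rule ccontr)
  assume "\<not> f x \<le> ereal s"
  then obtain d where d: "ereal s < d" "d < f x"
    using dense[of "ereal s" "f x"] by (auto simp: not_le)
  then have "d < Liminf (at x) f"
    using f order.strict_trans2 unfolding lsc_def by blast
  then have "\<forall>\<^sub>F y in at x. d < f y"
    by (rule less_LiminfD)
  then have "\<forall>\<^sub>F y in nhds x. d < f y"
    using d by (simp add: eventually_nhds_conv_at)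
  then have "\<forall>\<^sub>F n in sequentially. d < f (X n)"
    using X by (rule eventually_compose_filterlim)
  moreover have "\<forall>\<^sub>F n in sequentially. ereal (c n) < d"
    using c d(1) by (intro order_tendstoD(2)[of "\<lambda>n. ereal (c n)" "ereal s"]) auto
  ultimately have "\<forall>\<^sub>F n in sequentially. False"
  proof eventually_elim
    case (elim n)
    then show ?case using le[of n] by order
  qed
  then show False by simp
qed

text \<open>If \<open>f\<close> stayed above a positive constant from some index on, the series would dominate a multiple of
  the harmonic series.\<close>

lemma summable_divide_Suc_imp_subseq_tendsto_0:
  fixes f :: "nat \<Rightarrow> real"
  assumes pos: "\<And>k. 0 \<le> f k" and sum: "summable (\<lambda>k. f k / real (Suc k))"
  shows "\<exists>s. strict_mono s \<and> (\<lambda>n. f (s n)) \<longlonglongrightarrow> 0"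
proof -
  have ex: "\<exists>k>N. f k < d" if "0 < d" for N d
  proof (rule ccontr)
    assume "\<not> ?thesis"
    then have ge: "d \<le> f k" if "k > N" for k
      using that by (meson not_le)
    have "summable (\<lambda>k. d * inverse (real (Suc k)))"
    proof (rule summable_comparison_test[OF _ sum], intro exI[of _ "Suc N"] allI impI)
      fix k assume "Suc N \<le> k"
      then show "norm (d * inverse (real (Suc k))) \<le> f k / real (Suc k)"
        using ge[of k] that by (simp add: divide_inverse mult_right_mono abs_mult)
    qed
    then have "summable (\<lambda>k. inverse (real (Suc k)))"
      using that by (simp add: summable_cmult_iff del: of_nat_Suc)
    then show False
      using not_summable_harmonic[where 'a = real] summable_Suc_iff[of "\<lambda>n. inverse (real n)"]
      by simp
  qed
  have "\<exists>s. \<forall>n. f (s n) < inverse (real (Suc n)) \<and> s n < s (Suc n)"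
  proof (rule dependent_nat_choice)
    show "\<exists>k. f k < inverse (real (Suc 0))"
      using ex[of 1 0] by auto
    show "\<exists>k'. f k' < inverse (real (Suc (Suc n))) \<and> k < k'" for k n
      using ex[of "inverse (real (Suc (Suc n)))" k] by (auto simp del: of_nat_Suc)
  qed
  then obtain s where s: "\<And>n. f (s n) < inverse (real (Suc n))" "\<And>n. s n < s (Suc n)"
    by blast
  have "(\<lambda>n. f (s n)) \<longlonglongrightarrow> 0"
    by (rule real_tendsto_sandwich[OF _ _ tendsto_const LIMSEQ_inverse_real_of_nat])
      (use pos s(1) in \<open>auto intro!: always_eventually less_imp_le\<close>)
  with s(2) show ?thesis
    using strict_mono_Suc_iff by blast
qed

lemma summable_of_decrease:
  fixes e x :: "nat \<Rightarrow> real"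
  assumes e: "\<And>k. 0 \<le> e k" and x: "\<And>k. 0 \<le> x k" and step: "\<And>k. e (Suc k) + x k \<le> e k"
  shows "summable x"
proof (rule summableI_nonneg_bounded)
  fix n
  have "(\<Sum>i<n. x i) + e n \<le> e 0"
  proof (induction n)
    case (Suc n)
    then show ?case using step[of n] by simp
  qed simp
  then show "(\<Sum>i<n. x i) \<le> e 0"
    using e[of n] by simp
qed (rule x)

text \<open>Sequential lower semicontinuity at one point, stated with real upper bounds \<open>c\<close> so that it can be used
  on the part of the domain of an extended-valued function where that function is finite.\<close>

definition seq_lsc_at :: "'a::topological_space set \<Rightarrow> ('a \<Rightarrow> real) \<Rightarrow> 'a \<Rightarrow> bool" where
  "seq_lsc_at D F x \<longleftrightarrow> (\<forall>X c l. (\<forall>n. X n \<in> D \<and> F (X n) \<le> c n) \<longrightarrow> X \<longlonglongrightarrow> x \<longrightarrow> c \<longlonglongrightarrow> l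
     \<longrightarrow> F x \<le> l)"

lemma seq_lsc_atD:
  assumes "seq_lsc_at D F x" "\<And>n. X n \<in> D" "\<And>n. F (X n) \<le> c n" "X \<longlonglongrightarrow> x" "c \<longlonglongrightarrow> l"
  shows "F x \<le> l"
  using assms unfolding seq_lsc_at_def by blast

section \<open>Energy of the weighted recursion\<close>

text \<open>The algorithm enters the convergence analysis only through its one-step inequality, assumption \<open>step\<close>.
  The set \<open>D\<close> is the part of the constraint set on which the objective \<open>F\<close> is finite, so every quantity is
  real-valued. Membership in \<open>D\<close> starts at \<open>u 1\<close> because the initial point may have infinite objective.\<close>

locale primal_dual_recursion =
  fixes D :: "'a::euclidean_space set" and P :: "'b::euclidean_space set"
    and F :: "'a \<Rightarrow> real" and \<Theta> :: "'a \<Rightarrow> 'b"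
    and u :: "nat \<Rightarrow> 'a" and p q :: "nat \<Rightarrow> 'b" and \<beta> \<eta> c0 :: real
  assumes convex_D: "convex D"
    and convex_P: "convex P" and closed_P: "closed P" and cone_P: "cone P"
    and \<beta>_pos: "0 < \<beta>" and \<eta>_pos: "0 < \<eta>" and c0_ge_1: "1 \<le> c0"
    and u_in: "\<And>k. u (Suc k) \<in> D" and p_in: "\<And>k. p k \<in> P" and q_in: "\<And>k. q k \<in> P"
    and F_sc: "strongly_convex_on D F \<beta>"
    and \<Theta>_conv: "\<And>r. r \<in> P \<Longrightarrow> convex_on D (\<lambda>v. r \<bullet> \<Theta> v)"
    and step: "\<And>k v r. v \<in> D \<Longrightarrow> r \<in> P \<Longrightarrow>
      (F (u (Suc k)) + r \<bullet> \<Theta> (u (Suc k))) - (F v + q k \<bullet> \<Theta> v)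
      \<le> \<beta> / 4 * (c0 + real k - 1) * (norm (v - u k))\<^sup>2
        - \<beta> / 4 * (c0 + real k + 1) * (norm (v - u (Suc k)))\<^sup>2
        - \<beta> / 2 * (norm (u (Suc k) - u k))\<^sup>2
        + ((norm (r - p k))\<^sup>2 - (norm (r - p (Suc k)))\<^sup>2 - (norm (q k - p k))\<^sup>2)
          / (2 * ((real k + 1) * \<eta>))"
begin

definition Lag :: "'a \<Rightarrow> 'b \<Rightarrow> real" where
  "Lag v r = F v + r \<bullet> \<Theta> v"

definition energy :: "'a \<Rightarrow> 'b \<Rightarrow> nat \<Rightarrow> real" where
  "energy v r k = \<beta> / 4 * ((c0 + real k) * (c0 + real k - 1)) * (norm (v - u k))\<^sup>2
    + (c0 + real k) / (2 * ((real k + 1) * \<eta>)) * (norm (r - p k))\<^sup>2"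

text \<open>A single inequality between \<open>L(us, r)\<close> and \<open>L(v, ps)\<close> is equivalent to the usual pair: take \<open>v = us\<close> or
  \<open>r = ps\<close>. It is also the form in which saddle points arise as limits of the one-step inequality.\<close>

definition saddle :: "'a \<Rightarrow> 'b \<Rightarrow> bool" where
  "saddle us ps \<longleftrightarrow> us \<in> D \<and> ps \<in> P \<and> (\<forall>v\<in>D. \<forall>r\<in>P. Lag us r \<le> Lag v ps)"

definition ubar :: "nat \<Rightarrow> 'a" where
  "ubar t = (\<Sum>k=0..t. (c0 + real k) *\<^sub>R u (Suc k)) /\<^sub>R (\<Sum>k=0..t. c0 + real k)"

definition pbar :: "nat \<Rightarrow> 'b" where
  "pbar t = (\<Sum>k=0..t. (c0 + real k) *\<^sub>R q k) /\<^sub>R (\<Sum>k=0..t. c0 + real k)"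

lemma P_nonempty: "P \<noteq> {}"
  using p_in by blast

lemma zero_in_P: "0 \<in> P"
  using cone_P P_nonempty by (simp add: cone_contains_0)

lemma dual_weight_ge: "1 / (2 * \<eta>) \<le> (c0 + real k) / (2 * ((real k + 1) * \<eta>))"
proof -
  have "1 / (2 * \<eta>) \<le> (c0 + real k) / (real k + 1) / (2 * \<eta>)"
    using \<eta>_pos c0_ge_1 by (intro divide_right_mono) auto
  then show ?thesis
    by (simp add: mult_ac)
qed

lemma dual_weight_le: "(c0 + real k) / (2 * ((real k + 1) * \<eta>)) \<le> c0 / (2 * \<eta>)"
proof -
  have "c0 + real k \<le> c0 * (real k + 1)"
    using c0_ge_1 mult_right_mono[of 1 c0 "real k"] by (simp add: algebra_simps)
  then have "(c0 + real k) / (real k + 1) \<le> c0"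
    by (simp add: pos_divide_le_eq)
  then have "(c0 + real k) / (real k + 1) / (2 * \<eta>) \<le> c0 / (2 * \<eta>)"
    using \<eta>_pos by (intro divide_right_mono) auto
  then show ?thesis
    by (simp add: mult_ac)
qed

lemma dual_weight_decreasing:
  "(c0 + real (Suc k)) / (2 * ((real (Suc k) + 1) * \<eta>)) \<le> (c0 + real k) / (2 * ((real k + 1) * \<eta>))"
proof -
  have "(c0 + real (Suc k)) / (real (Suc k) + 1) \<le> (c0 + real k) / (real k + 1)"
    using c0_ge_1 by (simp add: divide_simps) (simp add: algebra_simps)
  then have "(c0 + real (Suc k)) / (real (Suc k) + 1) / (2 * \<eta>) \<le> (c0 + real k) / (real k + 1) / (2 * \<eta>)"
    using \<eta>_pos by (intro divide_right_mono) auto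
  then show ?thesis
    by (simp add: mult_ac)
qed

lemma energy_ge_dual: "(norm (r - p k))\<^sup>2 / (2 * \<eta>) \<le> energy v r k"
proof -
  have "1 / (2 * \<eta>) * (norm (r - p k))\<^sup>2
      \<le> (c0 + real k) / (2 * ((real k + 1) * \<eta>)) * (norm (r - p k))\<^sup>2"
    by (intro mult_right_mono dual_weight_ge) simp
  moreover have "0 \<le> \<beta> / 4 * ((c0 + real k) * (c0 + real k - 1)) * (norm (v - u k))\<^sup>2"
    using \<beta>_pos c0_ge_1 by simp
  ultimately show ?thesis
    by (simp add: energy_def)
qed

lemma energy_ge_primal: "\<beta> / 4 * ((real k)\<^sup>2 * (norm (v - u k))\<^sup>2) \<le> energy v r k"
proof -
  have "real k * real k \<le> (c0 + real k) * (c0 + real k - 1)"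
    using c0_ge_1 by (intro mult_mono) auto
  then have "\<beta> / 4 * (real k)\<^sup>2 * (norm (v - u k))\<^sup>2
      \<le> \<beta> / 4 * ((c0 + real k) * (c0 + real k - 1)) * (norm (v - u k))\<^sup>2"
    unfolding power2_eq_square[of "real k"]
    using \<beta>_pos by (intro mult_right_mono mult_left_mono) auto
  moreover have "0 \<le> (c0 + real k) / (2 * ((real k + 1) * \<eta>)) * (norm (r - p k))\<^sup>2"
    using \<eta>_pos c0_ge_1 by simp
  ultimately show ?thesis
    unfolding energy_def mult.assoc by linarith
qed

lemma energy_nonneg: "0 \<le> energy v r k"
  using energy_ge_dual[of r k v] \<eta>_pos by (meson divide_nonneg_pos mult_pos_pos order_trans zero_le_power2 zero_less_numeral)

text \<open>This is where the weights \<open>c0 + k\<close> matter: multiplication by them makes the outgoing primal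
  coefficient \<open>\<beta>/4 (c0 + k) (c0 + k + 1)\<close> equal to the incoming one of the next step, and the dual
  coefficient can only decrease since \<open>c0 \<ge> 1\<close>.\<close>

lemma energy_step:
  assumes "v \<in> D" "r \<in> P"
  shows "(c0 + real k) * (Lag (u (Suc k)) r - Lag v (q k)) + energy v r (Suc k)
      + (c0 + real k) * (\<beta> / 2 * (norm (u (Suc k) - u k))\<^sup>2) + (norm (q k - p k))\<^sup>2 / (2 * \<eta>)
    \<le> energy v r k"
proof -
  define w where "w = c0 + real k"
  define s where "s = 2 * ((real k + 1) * \<eta>)"
  define X where "X = (norm (v - u k))\<^sup>2"
  define X' where "X' = (norm (v - u (Suc k)))\<^sup>2"
  define Y where "Y = (norm (r - p k))\<^sup>2"
  define Y' where "Y' = (norm (r - p (Suc k)))\<^sup>2"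
  define Z where "Z = (norm (u (Suc k) - u k))\<^sup>2"
  define Q where "Q = (norm (q k - p k))\<^sup>2"
  have w: "0 \<le> w"
    using c0_ge_1 by (simp add: w_def)
  have "Lag (u (Suc k)) r - Lag v (q k)
      \<le> \<beta> / 4 * (w - 1) * X - \<beta> / 4 * (w + 1) * X' - \<beta> / 2 * Z + (Y - Y' - Q) / s"
    using step[OF assms, of k]
    by (simp add: Lag_def w_def s_def X_def X'_def Y_def Y'_def Z_def Q_def)
  then have "w * (Lag (u (Suc k)) r - Lag v (q k))
      \<le> w * (\<beta> / 4 * (w - 1) * X - \<beta> / 4 * (w + 1) * X' - \<beta> / 2 * Z + (Y - Y' - Q) / s)"
    using w by (rule mult_left_mono)
  also have "\<dots> = \<beta> / 4 * (w * (w - 1)) * X - \<beta> / 4 * ((w + 1) * w) * X' - w * (\<beta> / 2 * Z)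
      + w / s * Y - w / s * Y' - w / s * Q"
    by (simp add: algebra_simps add_divide_distrib diff_divide_distrib)
  finally have main: "w * (Lag (u (Suc k)) r - Lag v (q k)) \<le> \<dots>" .
  have "(c0 + real (Suc k)) / (2 * ((real (Suc k) + 1) * \<eta>)) * Y' \<le> w / s * Y'"
    unfolding w_def s_def Y'_def by (intro mult_right_mono dual_weight_decreasing) simp
  moreover have "1 / (2 * \<eta>) * Q \<le> w / s * Q"
    unfolding w_def s_def Q_def by (intro mult_right_mono dual_weight_ge) simp
  moreover have "energy v r k = \<beta> / 4 * (w * (w - 1)) * X + w / s * Y"
    by (simp add: energy_def w_def s_def X_def Y_def)
  moreover have "energy v r (Suc k) = \<beta> / 4 * ((w + 1) * w) * X'
      + (c0 + real (Suc k)) / (2 * ((real (Suc k) + 1) * \<eta>)) * Y'"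
    by (simp add: energy_def w_def X'_def Y'_def algebra_simps)
  ultimately show ?thesis
    using main unfolding w_def[symmetric] Z_def[symmetric] Q_def[symmetric] by simp
qed

lemma energy_sum:
  assumes "v \<in> D" "r \<in> P"
  shows "(\<Sum>k=0..t. (c0 + real k) * (Lag (u (Suc k)) r - Lag v (q k))) \<le> energy v r 0"
proof -
  have le: "(c0 + real k) * (Lag (u (Suc k)) r - Lag v (q k)) + energy v r (Suc k) \<le> energy v r k"
    for k
  proof -
    have "0 \<le> (c0 + real k) * (\<beta> / 2 * (norm (u (Suc k) - u k))\<^sup>2)"
      "0 \<le> (norm (q k - p k))\<^sup>2 / (2 * \<eta>)"
      using c0_ge_1 \<beta>_pos \<eta>_pos by simp_all
    then show ?thesis
      using energy_step[OF assms, of k] by linarith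
  qed
  have "(\<Sum>k=0..t. (c0 + real k) * (Lag (u (Suc k)) r - Lag v (q k))) + energy v r (Suc t)
      \<le> energy v r 0"
  proof (induction t)
    case 0
    then show ?case using le[of 0] by simp
  next
    case (Suc t)
    then show ?case using le[of "Suc t"] by simp
  qed
  then show ?thesis
    using energy_nonneg[of v r "Suc t"] by linarith
qed

lemma weight_sum: "(\<Sum>k=0..t. c0 + real k) = (real t + 1) * (real t + 2 * c0) / 2"
  by (induction t) (simp_all add: field_simps)

lemma weight_sum_pos: "0 < (\<Sum>k=0..t. c0 + real k)"
  unfolding weight_sum using c0_ge_1 by simp

lemma Lag_convex: "r \<in> P \<Longrightarrow> convex_on D (\<lambda>v. Lag v r)"
  unfolding Lag_def
  using F_sc \<beta>_pos convex_D
  by (intro convex_on_add \<Theta>_conv) (auto intro: strongly_convex_on_imp_convex_on)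

lemma ubar_eq: "ubar t = (\<Sum>k=0..t. ((c0 + real k) / (\<Sum>k=0..t. c0 + real k)) *\<^sub>R u (Suc k))"
  unfolding ubar_def by (simp add: scaleR_right.sum divide_inverse mult.commute)

lemma pbar_eq: "pbar t = (\<Sum>k=0..t. ((c0 + real k) / (\<Sum>k=0..t. c0 + real k)) *\<^sub>R q k)"
  unfolding pbar_def by (simp add: scaleR_right.sum divide_inverse mult.commute)

lemma
  shows normalized_weight_sum: "(\<Sum>k=0..t. (c0 + real k) / (\<Sum>k=0..t. c0 + real k)) = 1"
    and normalized_weight_nonneg: "0 \<le> (c0 + real k) / (\<Sum>k=0..t. c0 + real k)"
  using weight_sum_pos[of t] c0_ge_1
  by (simp_all add: sum_divide_distrib[symmetric])

lemma ubar_in: "ubar t \<in> D"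
  unfolding ubar_eq
  using convex_D u_in normalized_weight_sum normalized_weight_nonneg
  by (intro convex_sum) auto

lemma pbar_in: "pbar t \<in> P"
  unfolding pbar_eq
  using convex_P q_in normalized_weight_sum normalized_weight_nonneg
  by (intro convex_sum) auto

section \<open>Rates at the averaged iterates\<close>

text \<open>Jensen's inequality in the first argument of the Lagrangian and equality in the second one, applied to
  the telescoped sum.\<close>

lemma ergodic_gap:
  assumes v: "v \<in> D" and r: "r \<in> P"
  shows "Lag (ubar t) r - Lag v (pbar t) \<le> 2 * energy v r 0 / ((real t + 1) * (real t + 2 * c0))"
proof -
  define W where "W = (\<Sum>k=0..t. c0 + real k)"
  have W: "0 < W" "W = (real t + 1) * (real t + 2 * c0) / 2"
    using weight_sum_pos[of t] weight_sum[of t] by (auto simp only: W_def)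
  have sum1: "(\<Sum>k=0..t. (c0 + real k) / W) = 1"
    using normalized_weight_sum by (simp add: W_def)
  have "Lag (ubar t) r \<le> (\<Sum>k=0..t. (c0 + real k) / W * Lag (u (Suc k)) r)"
    unfolding ubar_eq W_def
    using Lag_convex[OF r] u_in normalized_weight_sum normalized_weight_nonneg
    by (intro convex_on_sum) auto
  moreover have "Lag v (pbar t) = (\<Sum>k=0..t. (c0 + real k) / W * Lag v (q k))"
  proof -
    have "(\<Sum>k=0..t. (c0 + real k) / W * Lag v (q k))
        = (\<Sum>k=0..t. (c0 + real k) / W) * F v + (\<Sum>k=0..t. (c0 + real k) / W * (q k \<bullet> \<Theta> v))"
      by (simp only: Lag_def distrib_left sum.distrib sum_distrib_right)
    then show ?thesis
      unfolding sum1 by (simp add: Lag_def pbar_eq W_def inner_sum_left)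
  qed
  ultimately have "Lag (ubar t) r - Lag v (pbar t)
      \<le> (\<Sum>k=0..t. (c0 + real k) / W * Lag (u (Suc k)) r)
        - (\<Sum>k=0..t. (c0 + real k) / W * Lag v (q k))"
    by simp
  also have "\<dots> = (\<Sum>k=0..t. (c0 + real k) * (Lag (u (Suc k)) r - Lag v (q k))) / W"
    by (simp add: sum_subtractf[symmetric] sum_divide_distrib right_diff_distrib diff_divide_distrib)
  also have "\<dots> \<le> energy v r 0 / W"
    using energy_sum[OF v r] W by (intro divide_right_mono) auto
  also have "\<dots> = 2 * energy v r 0 / ((real t + 1) * (real t + 2 * c0))"
    unfolding W by simp
  finally show ?thesis .
qed

lemma rate_le:
  assumes "1 \<le> t" "0 \<le> A"
  shows "A / ((real t + 1) * (real t + 2 * c0)) \<le> A / (real t)\<^sup>2"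
proof (rule divide_left_mono)
  show "(real t)\<^sup>2 \<le> (real t + 1) * (real t + 2 * c0)"
    unfolding power2_eq_square using c0_ge_1 by (intro mult_mono) auto
  show "0 < ((real t + 1) * (real t + 2 * c0)) * (real t)\<^sup>2"
    using assms c0_ge_1 by simp
qed (rule assms)

section \<open>Saddle points and the vanishing energy\<close>

lemma saddle_growth:
  assumes s: "saddle us ps" and v: "v \<in> D"
  shows "Lag us ps + \<beta> / 2 * (norm (v - us))\<^sup>2 \<le> Lag v ps"
proof (rule strongly_convex_on_quadratic_growth[OF _ convex_D _ v])
  have "strongly_convex_on D (\<lambda>v. F v + ps \<bullet> \<Theta> v) (\<beta> + 0)"
    using s by (intro strongly_convex_on_add F_sc convex_on_imp_strongly_convex_on_0 \<Theta>_conv)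
      (auto simp: saddle_def)
  then show "strongly_convex_on D (\<lambda>v. Lag v ps) \<beta>"
    by (simp add: Lag_def)
qed (use s in \<open>auto simp: saddle_def\<close>)

text \<open>Test the maximality of \<open>ps\<close> over the cone at \<open>0\<close> and at \<open>2 ps\<close>.\<close>

lemma saddle_complementarity:
  assumes s: "saddle us ps"
  shows "ps \<bullet> \<Theta> us = 0" and "r \<in> P \<Longrightarrow> r \<bullet> \<Theta> us \<le> 0"
proof -
  have le: "r \<bullet> \<Theta> us \<le> ps \<bullet> \<Theta> us" if "r \<in> P" for r
    using s that by (auto simp: saddle_def Lag_def)
  have "ps \<in> P"
    using s by (simp add: saddle_def)
  then have "2 *\<^sub>R ps \<in> P"
    using cone_P by (simp add: cone_def)
  from le[OF this] le[OF zero_in_P] show *: "ps \<bullet> \<Theta> us = 0"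
    by simp
  show "r \<in> P \<Longrightarrow> r \<bullet> \<Theta> us \<le> 0"
    using le[of r] * by simp
qed

text \<open>At a saddle point the gap term in the energy inequality is itself bounded below by
  \<open>\<beta>/2 |u (Suc k) - us|\<^sup>2\<close>; this extra decrease is what makes the distances summable with weight \<open>k\<close>.\<close>

lemma saddle_energy_step:
  assumes s: "saddle us ps"
  shows "energy us ps (Suc k)
      + ((c0 + real k) * (\<beta> / 2) * ((norm (u (Suc k) - us))\<^sup>2 + (norm (u (Suc k) - u k))\<^sup>2)
        + (norm (q k - p k))\<^sup>2 / (2 * \<eta>))
    \<le> energy us ps k"
proof -
  have D: "us \<in> D" "ps \<in> P"
    using s by (auto simp: saddle_def)
  have "Lag us (q k) \<le> Lag us ps"
    using s q_in D by (simp add: saddle_def)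
  then have "\<beta> / 2 * (norm (u (Suc k) - us))\<^sup>2 \<le> Lag (u (Suc k)) ps - Lag us (q k)"
    using saddle_growth[OF s u_in, of k] by linarith
  then have "(c0 + real k) * (\<beta> / 2 * (norm (u (Suc k) - us))\<^sup>2)
      \<le> (c0 + real k) * (Lag (u (Suc k)) ps - Lag us (q k))"
    using c0_ge_1 by (intro mult_left_mono) auto
  then show ?thesis
    using energy_step[OF D, of k] by (simp add: algebra_simps)
qed

lemma
  assumes s: "saddle us ps"
  shows energy_decseq: "decseq (energy us ps)"
    and summable_increments: "summable (\<lambda>k. (c0 + real k) * (\<beta> / 2)
      * ((norm (u (Suc k) - us))\<^sup>2 + (norm (u (Suc k) - u k))\<^sup>2))"
    and summable_dual_increments: "summable (\<lambda>k. (norm (q k - p k))\<^sup>2 / (2 * \<eta>))"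
proof -
  let ?A = "\<lambda>k. (c0 + real k) * (\<beta> / 2)
      * ((norm (u (Suc k) - us))\<^sup>2 + (norm (u (Suc k) - u k))\<^sup>2)"
  let ?B = "\<lambda>k. (norm (q k - p k))\<^sup>2 / (2 * \<eta>)"
  have A: "0 \<le> ?A k" and B: "0 \<le> ?B k" for k
    using c0_ge_1 \<beta>_pos \<eta>_pos by simp_all
  have le: "energy us ps (Suc k) + (?A k + ?B k) \<le> energy us ps k" for k
    by (rule saddle_energy_step[OF s])
  show "decseq (energy us ps)"
  proof (rule decseq_SucI)
    fix k show "energy us ps (Suc k) \<le> energy us ps k"
      using le[of k] A[of k] B[of k] by linarith
  qed
  show "summable ?A"
    by (rule summable_of_decrease[of "energy us ps", OF energy_nonneg A])
      (use le B in \<open>smt (verit)\<close>)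
  show "summable ?B"
    by (rule summable_of_decrease[of "energy us ps", OF energy_nonneg B])
      (use le A in \<open>smt (verit)\<close>)
qed

text \<open>In the one-step inequality the primal terms combine to \<open>O(k) (|v - u k|\<^sup>2 - |v - u (Suc k)|\<^sup>2)\<close>, hence to
  \<open>O(k |u (Suc k) - u k|)\<close>, which the assumption \<open>slow\<close> controls; the dual terms vanish because their
  denominators grow with \<open>k\<close>. What survives in the limit is the saddle inequality.\<close>

lemma saddle_of_limit:
  assumes us: "us \<in> D"
    and lsc: "seq_lsc_at D F us"
    and cont: "continuous_on D \<Theta>"
    and s: "strict_mono s"
    and near: "(\<lambda>n. u (Suc (s n))) \<longlonglongrightarrow> us"
    and slow: "(\<lambda>n. (real (s n) + 1) * norm (u (Suc (s n)) - u (s n))) \<longlonglongrightarrow> 0"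
    and p: "(\<lambda>n. p (s n)) \<longlonglongrightarrow> r'" and q: "(\<lambda>n. q (s n)) \<longlonglongrightarrow> r'"
  shows "saddle us r'"
  unfolding saddle_def
proof (intro conjI ballI us)
  show "r' \<in> P"
    using closed_sequentially[OF closed_P _ p] p_in by blast
  fix v r assume v: "v \<in> D" and r: "r \<in> P"
  have \<Theta>lim: "(\<lambda>n. \<Theta> (u (Suc (s n)))) \<longlonglongrightarrow> \<Theta> us"
    using us u_in by (intro continuous_on_tendsto_compose[OF cont near]) auto
  have diff: "(\<lambda>n. norm (u (Suc (s n)) - u (s n))) \<longlonglongrightarrow> 0"
  proof (rule real_tendsto_sandwich[OF _ _ tendsto_const slow])
    show "\<forall>\<^sub>F n in sequentially. norm (u (Suc (s n)) - u (s n))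
        \<le> (real (s n) + 1) * norm (u (Suc (s n)) - u (s n))"
      by (intro always_eventually allI) (simp add: algebra_simps)
  qed simp
  have "(\<lambda>n. u (Suc (s n)) - (u (Suc (s n)) - u (s n))) \<longlonglongrightarrow> us - 0"
    using diff by (intro tendsto_diff near) (simp add: tendsto_norm_zero_iff)
  then have near': "(\<lambda>n. u (s n)) \<longlonglongrightarrow> us"
    by simp
  have inf: "filterlim (\<lambda>n. 2 * ((real (s n) + 1) * \<eta>)) at_top sequentially"
  proof -
    have "filterlim (\<lambda>n. real (s n)) at_top sequentially"
      by (rule filterlim_compose[OF filterlim_real_sequentially filterlim_subseq[OF s]])
    then have "filterlim (\<lambda>n. 1 + real (s n)) at_top sequentially"
      by (intro filterlim_tendsto_add_at_top[OF tendsto_const])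
    then have "filterlim (\<lambda>n. (2 * \<eta>) * (1 + real (s n))) at_top sequentially"
      using \<eta>_pos by (intro filterlim_tendsto_pos_mult_at_top[OF tendsto_const]) auto
    then show ?thesis
      by (simp add: algebra_simps)
  qed
  have "(\<lambda>n. (norm (r - p (s n)))\<^sup>2) \<longlonglongrightarrow> (norm (r - r'))\<^sup>2"
    by (intro tendsto_intros p)
  from real_tendsto_divide_at_top[OF this inf]
  have dual: "(\<lambda>n. (norm (r - p (s n)))\<^sup>2 / (2 * ((real (s n) + 1) * \<eta>))) \<longlonglongrightarrow> 0" .
  \<comment> \<open>An upper bound on \<open>F (u (Suc (s n)))\<close> from the one-step inequality at \<open>k = s n\<close>.\<close>
  define c where "c n = (F v + q (s n) \<bullet> \<Theta> v) - r \<bullet> \<Theta> (u (Suc (s n)))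
    + \<beta> / 4 * (c0 + 1) * ((real (s n) + 1) * norm (u (Suc (s n)) - u (s n)))
        * (norm (v - u (s n)) + norm (v - u (Suc (s n))))
    + (norm (r - p (s n)))\<^sup>2 / (2 * ((real (s n) + 1) * \<eta>))" for n
  have "c \<longlonglongrightarrow> (F v + r' \<bullet> \<Theta> v) - r \<bullet> \<Theta> us
      + \<beta> / 4 * (c0 + 1) * 0 * (norm (v - us) + norm (v - us)) + 0"
    unfolding c_def
    by (intro tendsto_intros q \<Theta>lim slow near near' dual)
  moreover have "F (u (Suc (s n))) \<le> c n" for n
  proof -
    define k where "k = s n"
    define x where "x = norm (v - u k)"
    define y where "y = norm (v - u (Suc k))"
    define d where "d = norm (u (Suc k) - u k)"
    have nn: "0 \<le> x" "0 \<le> y" "0 \<le> d"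
      by (simp_all add: x_def y_def d_def)
    have "x \<le> y + d"
      unfolding x_def y_def d_def
      by (metis diff_add_cancel add_diff_eq norm_triangle_ineq)
    then have "x\<^sup>2 - y\<^sup>2 \<le> d * (x + y)"
      using nn mult_right_mono[of "x - y" d "x + y"] by (simp add: power2_eq_square algebra_simps)
    then have 1: "\<beta> / 4 * (c0 + real k + 1) * (x\<^sup>2 - y\<^sup>2) \<le> \<beta> / 4 * (c0 + real k + 1) * (d * (x + y))"
      using \<beta>_pos c0_ge_1 by (intro mult_left_mono) auto
    have 2: "\<beta> / 4 * (c0 + real k + 1) * (d * (x + y))
        \<le> \<beta> / 4 * ((c0 + 1) * (real k + 1)) * (d * (x + y))"
      using \<beta>_pos c0_ge_1 nn
      by (intro mult_right_mono mult_left_mono) (auto simp: algebra_simps)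
    have 3: "\<beta> / 4 * (c0 + real k - 1) * x\<^sup>2 \<le> \<beta> / 4 * (c0 + real k + 1) * x\<^sup>2"
      using \<beta>_pos by (intro mult_right_mono mult_left_mono) auto
    have 4: "0 \<le> \<beta> / 2 * d\<^sup>2"
      using \<beta>_pos by simp
    have 5: "((norm (r - p k))\<^sup>2 - (norm (r - p (Suc k)))\<^sup>2 - (norm (q k - p k))\<^sup>2)
          / (2 * ((real k + 1) * \<eta>)) \<le> (norm (r - p k))\<^sup>2 / (2 * ((real k + 1) * \<eta>))"
      using \<eta>_pos by (intro divide_right_mono) auto
    have "F (u (Suc k)) \<le> (F v + q k \<bullet> \<Theta> v) - r \<bullet> \<Theta> (u (Suc k))
        + \<beta> / 4 * ((c0 + 1) * (real k + 1)) * (d * (x + y))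
        + (norm (r - p k))\<^sup>2 / (2 * ((real k + 1) * \<eta>))"
      using step[OF v r, of k] 1 2 3 4 5 unfolding x_def[symmetric] y_def[symmetric] d_def[symmetric]
      by (simp add: right_diff_distrib)
    then show ?thesis
      unfolding c_def k_def[symmetric] x_def[symmetric] y_def[symmetric] d_def[symmetric]
      by (simp add: mult_ac)
  qed
  ultimately have "F us \<le> (F v + r' \<bullet> \<Theta> v) - r \<bullet> \<Theta> us
      + \<beta> / 4 * (c0 + 1) * 0 * (norm (v - us) + norm (v - us)) + 0"
    using u_in by (intro seq_lsc_atD[OF lsc _ _ near]) auto
  then show "Lag us r \<le> Lag v r'"
    by (simp add: Lag_def)
qed

text \<open>The multiplier \<open>r\<close> is a cluster point of \<open>p\<close> and may differ from \<open>ps\<close>: the energy at \<open>(us, ps)\<close>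
  need not vanish, since \<open>p\<close> may stay away from \<open>ps\<close>.\<close>

lemma energy_tendsto_0:
  assumes sad: "saddle us ps"
    and lsc: "seq_lsc_at D F us"
    and cont: "continuous_on D \<Theta>"
  shows "\<exists>r. energy us r \<longlonglongrightarrow> 0"
proof -
  define f where "f k = (real k + 1)\<^sup>2 *
    ((norm (u (Suc k) - us))\<^sup>2 + (norm (u (Suc k) - u k))\<^sup>2)" for k
  have f_nonneg: "0 \<le> f k" for k
    by (simp add: f_def)
  have "summable (\<lambda>k. f k / real (Suc k))"
  proof (rule summable_comparison_test[OF _ summable_mult[OF summable_increments[OF sad],
          of "2 / \<beta>"]], intro exI[of _ 0] allI impI)
    fix k :: nat
    let ?g = "(norm (u (Suc k) - us))\<^sup>2 + (norm (u (Suc k) - u k))\<^sup>2"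
    have "norm (f k / real (Suc k)) = (real k + 1) * ?g"
      by (simp add: f_def power2_eq_square add.commute[of 1])
    also have "\<dots> \<le> (c0 + real k) * ?g"
      using c0_ge_1 by (intro mult_right_mono) auto
    also have "\<dots> = 2 / \<beta> * ((c0 + real k) * (\<beta> / 2) * ?g)"
      using \<beta>_pos by simp
    finally show "norm (f k / real (Suc k)) \<le> 2 / \<beta> * ((c0 + real k) * (\<beta> / 2) * ?g)" .
  qed
  \<comment> \<open>Two extractions: first the rescaled distances vanish, then the multipliers converge.\<close>
  then obtain s1 where s1: "strict_mono s1" "(\<lambda>n. f (s1 n)) \<longlonglongrightarrow> 0"
    using summable_divide_Suc_imp_subseq_tendsto_0[of f] f_nonneg by auto
  have "bounded (range (\<lambda>n. p (s1 n)))"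
  proof (rule boundedI)
    fix x assume "x \<in> range (\<lambda>n. p (s1 n))"
    then obtain k where x: "x = p k" by auto
    have "(norm (ps - p k))\<^sup>2 / (2 * \<eta>) \<le> energy us ps 0"
      using energy_ge_dual[of ps k us] decseqD[OF energy_decseq[OF sad], of 0 k] by simp
    then have "(norm (ps - p k))\<^sup>2 \<le> energy us ps 0 * (2 * \<eta>)"
      using \<eta>_pos by (simp add: pos_divide_le_eq)
    then have "norm (ps - p k) \<le> sqrt (energy us ps 0 * (2 * \<eta>))"
      by (rule real_le_rsqrt)
    moreover have "norm x \<le> norm ps + norm (ps - p k)"
      unfolding x by norm
    ultimately show "norm x \<le> norm ps + sqrt (energy us ps 0 * (2 * \<eta>))"
      by linarith
  qed
  then obtain r s2 where s2: "strict_mono s2" "((\<lambda>n. p (s1 n)) \<circ> s2) \<longlonglongrightarrow> r"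
    using bounded_imp_convergent_subsequence by blast
  define s where "s = s1 \<circ> s2"
  have s: "strict_mono s"
    using s1 s2 by (simp add: s_def strict_mono_o)
  have fs: "(\<lambda>n. f (s n)) \<longlonglongrightarrow> 0"
    using LIMSEQ_subseq_LIMSEQ[OF s1(2) s2(1)] by (simp add: s_def o_def)
  have ps: "(\<lambda>n. p (s n)) \<longlonglongrightarrow> r"
    using s2(2) by (simp add: s_def o_def)
  have sq: "(\<lambda>n. sqrt (f (s n))) \<longlonglongrightarrow> 0"
    using tendsto_real_sqrt[OF fs] by simp
  have near_le: "(real k + 1) * norm (u (Suc k) - us) \<le> sqrt (f k)"
    and slow_le: "(real k + 1) * norm (u (Suc k) - u k) \<le> sqrt (f k)" for k
    by (rule real_le_rsqrt, simp only: f_def power_mult_distrib distrib_left, simp)+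
  have slow: "(\<lambda>n. (real (s n) + 1) * norm (u (Suc (s n)) - u (s n))) \<longlonglongrightarrow> 0"
    by (rule real_tendsto_sandwich[OF _ _ tendsto_const sq])
      (auto intro!: always_eventually slow_le)
  have "(\<lambda>n. norm (u (Suc (s n)) - us)) \<longlonglongrightarrow> 0"
  proof (rule real_tendsto_sandwich[OF _ _ tendsto_const sq])
    have "norm (u (Suc k) - us) \<le> sqrt (f k)" for k
      using near_le[of k] mult_right_mono[of 1 "real k + 1" "norm (u (Suc k) - us)"] by simp
    then show "\<forall>\<^sub>F n in sequentially. norm (u (Suc (s n)) - us) \<le> sqrt (f (s n))"
      by simp
  qed simp
  then have near: "(\<lambda>n. u (Suc (s n))) \<longlonglongrightarrow> us"
    by (simp add: tendsto_norm_zero_iff LIM_zero_iff)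
  have "(\<lambda>k. (norm (q k - p k))\<^sup>2 / (2 * \<eta>)) \<longlonglongrightarrow> 0"
    using summable_dual_increments[OF sad] by (rule summable_LIMSEQ_zero)
  then have "(\<lambda>k. sqrt ((norm (q k - p k))\<^sup>2 / (2 * \<eta>) * (2 * \<eta>))) \<longlonglongrightarrow> sqrt (0 * (2 * \<eta>))"
    by (intro tendsto_real_sqrt tendsto_mult tendsto_const)
  then have "(\<lambda>k. q k - p k) \<longlonglongrightarrow> 0"
    using \<eta>_pos by (simp add: tendsto_norm_zero_iff)
  from LIMSEQ_subseq_LIMSEQ[OF this s] have "(\<lambda>n. q (s n) - p (s n)) \<longlonglongrightarrow> 0"
    by (simp add: o_def)
  from tendsto_add[OF this ps] have qs: "(\<lambda>n. q (s n)) \<longlonglongrightarrow> r"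
    by simp
  have sadr: "saddle us r"
    using sad by (intro saddle_of_limit[OF _ lsc cont s near slow ps qs]) (auto simp: saddle_def)
  have upper: "energy us r k \<le> \<beta> / 2 * c0\<^sup>2 * f k + c0 / (2 * \<eta>) * (norm (r - p k))\<^sup>2" for k
  proof -
    have "(c0 + real k) * (c0 + real k - 1) \<le> (c0 * (real k + 1)) * (c0 * (real k + 1))"
      using c0_ge_1 mult_right_mono[of 1 c0 "real k"] by (intro mult_mono) (auto simp: algebra_simps)
    then have w: "(c0 + real k) * (c0 + real k - 1) \<le> c0\<^sup>2 * (real k + 1)\<^sup>2"
      by (simp add: power2_eq_square mult_ac)
    have "(norm (us - u k))\<^sup>2 \<le> (norm (u (Suc k) - us) + norm (u (Suc k) - u k))\<^sup>2"
      by (rule power_mono) norm+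
    also have "\<dots> \<le> 2 * ((norm (u (Suc k) - us))\<^sup>2 + (norm (u (Suc k) - u k))\<^sup>2)"
      using sum_squares_bound[of "norm (u (Suc k) - us)" "norm (u (Suc k) - u k)"]
      by (simp add: power2_sum)
    finally have "\<beta> / 4 * ((c0 + real k) * (c0 + real k - 1)) * (norm (us - u k))\<^sup>2
        \<le> \<beta> / 4 * (c0\<^sup>2 * (real k + 1)\<^sup>2)
          * (2 * ((norm (u (Suc k) - us))\<^sup>2 + (norm (u (Suc k) - u k))\<^sup>2))"
      using \<beta>_pos by (intro mult_mono[OF mult_left_mono[OF w]]) auto
    also have "\<dots> = \<beta> / 2 * c0\<^sup>2 * f k"
      by (simp add: f_def mult_ac)
    finally have 1: "\<beta> / 4 * ((c0 + real k) * (c0 + real k - 1)) * (norm (us - u k))\<^sup>2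
        \<le> \<beta> / 2 * c0\<^sup>2 * f k" .
    have "(c0 + real k) / (2 * ((real k + 1) * \<eta>)) \<le> c0 / (2 * \<eta>)"
      by (rule dual_weight_le)
    then have "(c0 + real k) / (2 * ((real k + 1) * \<eta>)) * (norm (r - p k))\<^sup>2
        \<le> c0 / (2 * \<eta>) * (norm (r - p k))\<^sup>2"
      by (intro mult_right_mono) auto
    with 1 show ?thesis
      by (simp add: energy_def)
  qed
  have "(\<lambda>n. \<beta> / 2 * c0\<^sup>2 * f (s n) + c0 / (2 * \<eta>) * (norm (r - p (s n)))\<^sup>2)
      \<longlonglongrightarrow> \<beta> / 2 * c0\<^sup>2 * 0 + c0 / (2 * \<eta>) * (norm (r - r))\<^sup>2"
    by (intro tendsto_intros fs ps)
  then have lim: "(\<lambda>n. \<beta> / 2 * c0\<^sup>2 * f (s n) + c0 / (2 * \<eta>) * (norm (r - p (s n)))\<^sup>2) \<longlonglongrightarrow> 0"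
    by simp
  have sub: "(\<lambda>n. energy us r (s n)) \<longlonglongrightarrow> 0"
    by (rule real_tendsto_sandwich[OF _ _ tendsto_const lim];
        intro always_eventually allI energy_nonneg upper)
  \<comment> \<open>The energy at the new saddle point is monotone, so its limit is the one along the subsequence.\<close>
  obtain l where l: "energy us r \<longlonglongrightarrow> l"
    using decseq_convergent[OF energy_decseq[OF sadr] allI[OF energy_nonneg]] by blast
  have "l = 0"
    using LIMSEQ_subseq_LIMSEQ[OF l s] sub LIMSEQ_unique by (simp add: o_def) blast
  with l show ?thesis
    by blast
qed

lemma primal_smallo:
  assumes "saddle us ps"
    and "seq_lsc_at D F us"
    and "continuous_on D \<Theta>"
  shows "(\<lambda>t. (norm (us - u t))\<^sup>2) \<in> o(\<lambda>t. 1 / (real t)\<^sup>2)"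
proof -
  obtain r where "energy us r \<longlonglongrightarrow> 0"
    using energy_tendsto_0[OF assms] by blast
  then have lim: "(\<lambda>t. 4 / \<beta> * energy us r t) \<longlonglongrightarrow> 0"
    by (rule tendsto_mult_right_zero)
  have le: "(real t)\<^sup>2 * (norm (us - u t))\<^sup>2 \<le> 4 / \<beta> * energy us r t" for t
    using energy_ge_primal[of t us r] \<beta>_pos by (simp add: field_simps)
  have "(\<lambda>t. (real t)\<^sup>2 * (norm (us - u t))\<^sup>2) \<longlonglongrightarrow> 0"
    by (rule real_tendsto_sandwich[OF _ _ tendsto_const lim])
      (use le in \<open>simp_all del: times_divide_eq_left times_divide_eq_right\<close>)
  then show ?thesis
    by (intro smalloI_tendsto) (auto simp: mult.commute eventually_sequentially intro!: exI[of _ 1])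
qed

section \<open>Feasibility and objective value\<close>

text \<open>Use the gap bound at \<open>us\<close> and at the multiplier \<open>ps + e\<close>, where \<open>e\<close> is the unit vector in the direction of
  the projected residual: the extra \<open>e\<close> contributes exactly the norm of that projection, while the rest of
  the gap is nonnegative by the saddle property.\<close>

lemma ergodic_feasibility:
  assumes s: "saddle us ps"
  shows "\<exists>c>0. \<forall>t\<ge>1. norm (closest_point P (\<Theta> (ubar t))) \<le> c / (real t)\<^sup>2"
proof -
  define E where "E = \<beta> / 4 * (c0 * (c0 - 1)) * (norm (us - u 0))\<^sup>2
    + c0 / (2 * \<eta>) * (norm (ps - p 0) + 1)\<^sup>2"
  define A where "A = 2 * E"
  have D: "us \<in> D" "ps \<in> P"
    using s by (auto simp: saddle_def)
  have A: "0 < A"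
  proof -
    have "0 < c0 / (2 * \<eta>) * (norm (ps - p 0) + 1)\<^sup>2"
      using \<eta>_pos c0_ge_1 by (intro mult_pos_pos divide_pos_pos zero_less_power) (auto intro: add_nonneg_pos)
    moreover have "0 \<le> \<beta> / 4 * (c0 * (c0 - 1)) * (norm (us - u 0))\<^sup>2"
      using \<beta>_pos c0_ge_1 by simp
    ultimately show ?thesis
      unfolding A_def E_def by (simp only: mult_pos_pos add_nonneg_pos zero_less_numeral)
  qed
  have "norm (closest_point P (\<Theta> (ubar t))) \<le> A / (real t)\<^sup>2" if t: "1 \<le> t" for t
  proof (cases "closest_point P (\<Theta> (ubar t)) = 0")
    case True
    then show ?thesis using A by simp
  next
    case False
    define z where "z = closest_point P (\<Theta> (ubar t))"
    define e where "e = z /\<^sub>R norm z"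
    have z: "z \<in> P" "z \<noteq> 0"
      using False closest_point_in_set[OF closed_P P_nonempty] by (auto simp: z_def)
    have e: "e \<in> P" "norm e = 1"
      using z cone_P by (auto simp: e_def cone_def)
    have pe: "ps + e \<in> P"
      using cone_P convex_P D e convex_cone by blast
    have "z \<bullet> \<Theta> (ubar t) = (norm z)\<^sup>2"
      unfolding z_def using convex_P closed_P cone_P P_nonempty by (rule closest_point_cone_inner_self)
    then have "e \<bullet> \<Theta> (ubar t) = norm z"
      using z by (simp add: e_def power2_eq_square field_simps)
    moreover have "Lag us (pbar t) \<le> Lag (ubar t) ps"
      using s ubar_in pbar_in by (simp add: saddle_def)
    ultimately have "norm z \<le> Lag (ubar t) (ps + e) - Lag us (pbar t)"
      by (simp add: Lag_def inner_add_left)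
    also have "\<dots> \<le> 2 * energy us (ps + e) 0 / ((real t + 1) * (real t + 2 * c0))"
      by (rule ergodic_gap[OF D(1) pe])
    also have "\<dots> \<le> A / ((real t + 1) * (real t + 2 * c0))"
    proof (rule divide_right_mono)
      have "norm (ps + e - p 0) \<le> norm (ps - p 0) + 1"
        using norm_triangle_ineq[of "ps - p 0" e] e by (simp add: algebra_simps)
      then have "(norm (ps + e - p 0))\<^sup>2 \<le> (norm (ps - p 0) + 1)\<^sup>2"
        by (rule power_mono) simp
      then have "c0 / (2 * \<eta>) * (norm (ps + e - p 0))\<^sup>2 \<le> c0 / (2 * \<eta>) * (norm (ps - p 0) + 1)\<^sup>2"
        using \<eta>_pos c0_ge_1 by (intro mult_left_mono) auto
      then have "energy us (ps + e) 0 \<le> E"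
        by (simp add: energy_def E_def)
      then show "2 * energy us (ps + e) 0 \<le> A"
        by (simp add: A_def)
    qed (use c0_ge_1 in simp)
    also have "\<dots> \<le> A / (real t)\<^sup>2"
      using t A by (intro rate_le) auto
    finally show ?thesis
      by (simp add: z_def)
  qed
  with A show ?thesis
    by blast
qed

text \<open>The upper bound is the gap at the multiplier \<open>0\<close>. For the lower bound, the saddle property allows the
  objective to drop by at most \<open>\<langle>ps, \<Theta> (ubar t)\<rangle>\<close>, which the projected residual controls.\<close>

lemma ergodic_objective:
  assumes s: "saddle us ps"
  shows "\<exists>c>0. \<forall>t\<ge>1. \<bar>F (ubar t) - F us\<bar> \<le> c / (real t)\<^sup>2"
proof -
  obtain c where c: "0 < c" "\<And>t. 1 \<le> t \<Longrightarrow> norm (closest_point P (\<Theta> (ubar t))) \<le> c / (real t)\<^sup>2"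
    using ergodic_feasibility[OF s] by blast
  have D: "us \<in> D" "ps \<in> P"
    using s by (auto simp: saddle_def)
  define A where "A = 2 * energy us 0 0 + norm ps * c + 1"
  have nn: "0 \<le> 2 * energy us 0 0" "0 \<le> norm ps * c"
    using energy_nonneg c by simp_all
  then have A: "0 < A" "2 * energy us 0 0 \<le> A" "norm ps * c \<le> A"
    by (simp_all add: A_def)
  have "\<bar>F (ubar t) - F us\<bar> \<le> A / (real t)\<^sup>2" if t: "1 \<le> t" for t
  proof -
    have "F (ubar t) - F us \<le> Lag (ubar t) 0 - Lag us (pbar t)"
      using saddle_complementarity(2)[OF s pbar_in] by (simp add: Lag_def)
    also have "\<dots> \<le> 2 * energy us 0 0 / ((real t + 1) * (real t + 2 * c0))"
      by (rule ergodic_gap[OF D(1) zero_in_P])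
    also have "\<dots> \<le> 2 * energy us 0 0 / (real t)\<^sup>2"
      using t nn by (intro rate_le) auto
    also have "\<dots> \<le> A / (real t)\<^sup>2"
      using A by (intro divide_right_mono) auto
    finally have up: "F (ubar t) - F us \<le> A / (real t)\<^sup>2" .
    have "F us = Lag us ps"
      using saddle_complementarity(1)[OF s] by (simp add: Lag_def)
    also have "\<dots> \<le> Lag (ubar t) ps"
      using s ubar_in D by (simp add: saddle_def)
    finally have "F us - F (ubar t) \<le> ps \<bullet> \<Theta> (ubar t)"
      by (simp add: Lag_def)
    also have "\<dots> \<le> ps \<bullet> closest_point P (\<Theta> (ubar t))"
      by (rule closest_point_cone_inner_le[OF convex_P closed_P cone_P D(2)])
    also have "\<dots> \<le> norm ps * norm (closest_point P (\<Theta> (ubar t)))"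
      by (rule norm_cauchy_schwarz)
    also have "\<dots> \<le> norm ps * (c / (real t)\<^sup>2)"
      using c(2)[OF t] by (intro mult_left_mono) auto
    also have "\<dots> = norm ps * c / (real t)\<^sup>2"
      by simp
    also have "\<dots> \<le> A / (real t)\<^sup>2"
      using A by (intro divide_right_mono) auto
    finally show ?thesis
      using up by linarith
  qed
  with A show ?thesis
    by blast
qed

end

section \<open>The algorithm\<close>

lemma GDERIV_inner_compose:
  fixes F :: "'a::euclidean_space \<Rightarrow> 'b::euclidean_space"
  assumes F: "F differentiable (at x)"
  shows "GDERIV (\<lambda>v. r \<bullet> F v) x :> gradient (\<lambda>v. r \<bullet> F v) x"
    and "r \<bullet> frechet_derivative F (at x) h = gradient (\<lambda>v. r \<bullet> F v) x \<bullet> h"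
proof -
  have "(F has_derivative frechet_derivative F (at x)) (at x)"
    using F by (simp add: frechet_derivative_works)
  then have d: "((\<lambda>v. r \<bullet> F v) has_derivative (\<lambda>h. r \<bullet> frechet_derivative F (at x) h)) (at x)"
    by (rule has_derivative_inner_right)
  then show g: "GDERIV (\<lambda>v. r \<bullet> F v) x :> gradient (\<lambda>v. r \<bullet> F v) x"
    by (intro GDERIV_gradient) (auto simp: differentiable_def)
  have "(\<lambda>h. r \<bullet> frechet_derivative F (at x) h) = (\<lambda>h. h \<bullet> gradient (\<lambda>v. r \<bullet> F v) x)"
    using d g unfolding gderiv_def by (rule has_derivative_unique)
  then show "r \<bullet> frechet_derivative F (at x) h = gradient (\<lambda>v. r \<bullet> F v) x \<bullet> h"
    by (metis inner_commute)
qed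

text \<open>For \<open>G\<close> and \<open>\<langle>q, \<Omega>\<rangle>\<close>, the increments from the old point \<open>z\<close> to \<open>w\<close> are bounded above by Lipschitz
  continuity of the gradient and those from \<open>z\<close> to \<open>v\<close> below by convexity, so the linear terms are those of
  the proximal subproblem. The error \<open>\<Theta> w - \<Theta> z\<close> of the predictor also costs a multiple of
  \<open>|w - z|\<^sup>2\<close>, and all these multiples are paid by the proximal term.\<close>

lemma linearized_primal_dual_step:
  fixes G j :: "'a::euclidean_space \<Rightarrow> real" and \<Omega> \<Phi> :: "'a \<Rightarrow> 'b::euclidean_space"
  assumes D: "convex D" "D \<subseteq> U" "w \<in> D" "v \<in> D" and U: "convex U" "z \<in> U"
    and P: "convex P" "closed P" "q \<in> P" "r \<in> P"
    and j: "convex_on D j" and \<Phi>: "convex_on D (\<lambda>v. q \<bullet> \<Phi> v)" and \<Omega>: "convex_on U (\<lambda>v. q \<bullet> \<Omega> v)"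
    and G: "strongly_convex_on U G \<beta>"
    and dG: "\<And>x. x \<in> U \<Longrightarrow> GDERIV G x :> gG x" "B_G-lipschitz_on U gG"
    and d\<Omega>: "\<And>x. x \<in> U \<Longrightarrow> GDERIV (\<lambda>v. q \<bullet> \<Omega> v) x :> g\<Omega> x" "B_\<Omega>-lipschitz_on U g\<Omega>"
    and \<Theta>: "\<tau>-lipschitz_on U (\<lambda>v. \<Omega> v + \<Phi> v)"
    and \<rho>: "0 < \<rho>"
    and q: "q = closest_point P (p + \<rho> *\<^sub>R (\<Omega> z + \<Phi> z))"
    and p': "p' = closest_point P (p + \<rho> *\<^sub>R (\<Omega> w + \<Phi> w))"
    and min: "\<And>x. x \<in> D \<Longrightarrow>
      (gG z + g\<Omega> z) \<bullet> w + (j w + q \<bullet> \<Phi> w) + (norm (w - z))\<^sup>2 / (2 * e)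
      \<le> (gG z + g\<Omega> z) \<bullet> x + (j x + q \<bullet> \<Phi> x) + (norm (x - z))\<^sup>2 / (2 * e)"
  shows "(G w + j w + r \<bullet> (\<Omega> w + \<Phi> w)) - (G v + j v + q \<bullet> (\<Omega> v + \<Phi> v))
    \<le> (1 / (2 * e) - \<beta> / 2) * (norm (v - z))\<^sup>2 - 1 / (2 * e) * (norm (v - w))\<^sup>2
      - (1 / e - B_G - B_\<Omega> - \<rho> * \<tau>\<^sup>2) / 2 * (norm (w - z))\<^sup>2
      + ((norm (r - p))\<^sup>2 - (norm (r - p'))\<^sup>2 - (norm (q - p))\<^sup>2) / (2 * \<rho>)"
proof -
  have wv: "w \<in> U" "v \<in> U"
    using D by auto
  have prox: "(j w + q \<bullet> \<Phi> w) - (j v + q \<bullet> \<Phi> v) + (gG z + g\<Omega> z) \<bullet> (w - v)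
      \<le> ((norm (v - z))\<^sup>2 - (norm (v - w))\<^sup>2 - (norm (w - z))\<^sup>2) / (2 * e)"
    by (rule proximal_step_inequality[OF D(1,3,4) convex_on_add[OF j \<Phi>] min])
  have G1: "G w \<le> G z + (w - z) \<bullet> gG z + B_G / 2 * (norm (w - z))\<^sup>2"
    by (rule lipschitz_gradient_upper_bound[OF U wv(1) dG])
  have G2: "G z + (v - z) \<bullet> gG z + \<beta> / 2 * (norm (v - z))\<^sup>2 \<le> G v"
    by (rule strongly_convex_on_gradient_inequality[OF G U(2) wv(2) dG(1)[OF U(2)]])
  have O1: "q \<bullet> \<Omega> w \<le> q \<bullet> \<Omega> z + (w - z) \<bullet> g\<Omega> z + B_\<Omega> / 2 * (norm (w - z))\<^sup>2"
    by (rule lipschitz_gradient_upper_bound[OF U wv(1) d\<Omega>])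
  have O2: "q \<bullet> \<Omega> z + (v - z) \<bullet> g\<Omega> z + 0 / 2 * (norm (v - z))\<^sup>2 \<le> q \<bullet> \<Omega> v"
    by (rule strongly_convex_on_gradient_inequality
        [OF convex_on_imp_strongly_convex_on_0[OF \<Omega>] U(2) wv(2) d\<Omega>(1)[OF U(2)]])
  have dual: "r \<bullet> (\<Omega> w + \<Phi> w) - q \<bullet> (\<Omega> w + \<Phi> w)
      \<le> ((norm (r - p))\<^sup>2 - (norm (r - p'))\<^sup>2 - (norm (q - p))\<^sup>2) / (2 * \<rho>)
        + \<rho> / 2 * (norm ((\<Omega> w + \<Phi> w) - (\<Omega> z + \<Phi> z)))\<^sup>2"
    by (rule projection_predictor_corrector[OF P(1,2,4) \<rho> q p'])
  have "norm ((\<Omega> w + \<Phi> w) - (\<Omega> z + \<Phi> z)) \<le> \<tau> * norm (w - z)"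
    using lipschitz_onD[OF \<Theta> wv(1) U(2)] by (simp add: dist_norm)
  then have "(norm ((\<Omega> w + \<Phi> w) - (\<Omega> z + \<Phi> z)))\<^sup>2 \<le> (\<tau> * norm (w - z))\<^sup>2"
    by (rule power_mono) simp
  then have "\<rho> / 2 * (norm ((\<Omega> w + \<Phi> w) - (\<Omega> z + \<Phi> z)))\<^sup>2 \<le> \<rho> / 2 * (\<tau>\<^sup>2 * (norm (w - z))\<^sup>2)"
    using \<rho> by (intro mult_left_mono) (auto simp: power_mult_distrib)
  with dual have dual': "r \<bullet> (\<Omega> w + \<Phi> w) - q \<bullet> (\<Omega> w + \<Phi> w)
      \<le> ((norm (r - p))\<^sup>2 - (norm (r - p'))\<^sup>2 - (norm (q - p))\<^sup>2) / (2 * \<rho>)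
        + \<rho> / 2 * (\<tau>\<^sup>2 * (norm (w - z))\<^sup>2)"
    by linarith
  have eq: "(gG z + g\<Omega> z) \<bullet> (w - v) = (w - z) \<bullet> gG z - (v - z) \<bullet> gG z
      + (w - z) \<bullet> g\<Omega> z - (v - z) \<bullet> g\<Omega> z"
    by (simp add: inner_simps inner_commute)
  define X where "X = (norm (v - z))\<^sup>2"
  define X' where "X' = (norm (v - w))\<^sup>2"
  define Z where "Z = (norm (w - z))\<^sup>2"
  define T where "T = ((norm (r - p))\<^sup>2 - (norm (r - p'))\<^sup>2 - (norm (q - p))\<^sup>2) / (2 * \<rho>)"
  have "(G w + j w + r \<bullet> (\<Omega> w + \<Phi> w)) - (G v + j v + q \<bullet> (\<Omega> v + \<Phi> v))
      \<le> (X - X' - Z) / (2 * e) + B_G / 2 * Z - \<beta> / 2 * X + B_\<Omega> / 2 * Z + T + \<rho> / 2 * (\<tau>\<^sup>2 * Z)"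
    using prox G1 G2 O1 O2 dual'
    unfolding eq X_def[symmetric] X'_def[symmetric] Z_def[symmetric] T_def[symmetric] inner_add_right
    by linarith
  also have "\<dots> = (1 / (2 * e) - \<beta> / 2) * X - 1 / (2 * e) * X'
      - (1 / e - B_G - B_\<Omega> - \<rho> * \<tau>\<^sup>2) / 2 * Z + T"
    by (simp add: algebra_simps add_divide_distrib diff_divide_distrib)
  finally show ?thesis
    unfolding X_def X'_def Z_def T_def .
qed

theorem theorem5:
  fixes U :: "(real ^ 'n) set" and C :: "(real ^ 'm) set"
    and G :: "real ^ 'n \<Rightarrow> real" and J :: "real ^ 'n \<Rightarrow> ereal"
    and \<Omega> \<Phi> \<Theta> :: "real ^ 'n \<Rightarrow> real ^ 'm"
    and L :: "real ^ 'n \<Rightarrow> real ^ 'm \<Rightarrow> ereal"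
    and B_G B_\<Omega> \<tau> \<beta>_G \<eta> c0 :: real
    and \<rho> \<epsilon> a b :: "nat \<Rightarrow> real"
    and u ubar :: "nat \<Rightarrow> real ^ 'n" and p q pbar :: "nat \<Rightarrow> real ^ 'm"
    and ustar :: "real ^ 'n" and pstar :: "real ^ 'm"
  assumes U: "U \<noteq> {}" "closed U" "convex U"
    and C: "C \<noteq> {}" "closed C" "convex C" "cone C"
    and Theta: "\<And>v. \<Theta> v = \<Omega> v + \<Phi> v"
    and L: "L = lagrangian G J \<Theta>"
    and H1: "\<And>v. J v \<noteq> -\<infinity>" "ereal_convex J" "lsc J" "effective_domain J \<inter> U \<noteq> {}"
    and H2: "convex_on UNIV G" "\<And>v. G differentiable (at v)"
      "B_G-lipschitz_on UNIV (gradient G)"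
    and H3: "cone_convex_on C U \<Omega>" "cone_convex_on C U \<Phi>"
    and H4: "\<And>v. \<Omega> differentiable (at v)"
      "\<And>r. B_\<Omega>-lipschitz_on U (gradient (\<lambda>v. r \<bullet> \<Omega> v))"
    and H5: "\<tau> > 0" "\<exists>S. open S \<and> U \<subseteq> S \<and> \<tau>-lipschitz_on S \<Theta>"
    and H6: "interior C \<noteq> {} \<longrightarrow> \<Theta> ` U \<inter> uminus ` interior C \<noteq> {}"
      "C = {0} \<longrightarrow> 0 \<in> interior (\<Theta> ` U)"
    and H7: "\<exists>us ps. saddle_point L U (dual_cone C) us ps"
    and G_strong: "\<beta>_G > 0" "strongly_convex G \<beta>_G"
    and eta: "\<eta> = \<beta>_G / (2 * \<tau>\<^sup>2)"
    and rho: "\<And>k. \<rho> k = (real k + 1) * \<eta>"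
    and eps: "\<And>k. \<epsilon> k = 1 / ((real k + 1) * \<eta> * \<tau>\<^sup>2 + B_G + B_\<Omega> + \<beta>_G)"
    and alg: "vapp_s U C G J \<Omega> \<Phi> \<rho> \<epsilon> u p q"
    and saddle: "saddle_point L U (dual_cone C) ustar pstar"
    and c0: "c0 = 2 * (B_G + B_\<Omega>) / \<beta>_G + 2"
    and a: "\<And>k. a k = (c0 + real k) * (1 / (2 * \<epsilon> k) - \<beta>_G / 2)"
    and b: "\<And>k. b k = (c0 + real k) / (2 * \<rho> k)"
    and ubar: "\<And>t. ubar t = (\<Sum>k=0..t. (c0 + real k) *\<^sub>R u (Suc k)) /\<^sub>R (\<Sum>k=0..t. c0 + real k)"
    and pbar: "\<And>t. pbar t = (\<Sum>k=0..t. (c0 + real k) *\<^sub>R q k) /\<^sub>R (\<Sum>k=0..t. c0 + real k)"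
  shows "(\<lambda>t. (norm (ustar - u t))\<^sup>2) \<in> o(\<lambda>t. 1 / (real t)\<^sup>2) \<and>
    (\<forall>t. \<forall>v\<in>U. \<forall>r\<in>dual_cone C.
       L (ubar t) r - L v (pbar t)
         \<le> ereal ((2 * a 0 * (norm (v - u 0))\<^sup>2 + 2 * b 0 * (norm (r - p 0))\<^sup>2)
                   / ((real t + 1) * (real t + 2 * c0)))) \<and>
    (\<exists>c>0. \<forall>t\<ge>1. norm (closest_point (dual_cone C) (\<Theta> (ubar t))) \<le> c / (real t)\<^sup>2) \<and>
    (\<exists>c>0. \<forall>t\<ge>1. \<bar>objective G J (ubar t) - objective G J ustar\<bar> \<le> ereal (c / (real t)\<^sup>2))"
proof -
  \<comment> \<open>The whole analysis runs on \<open>D\<close>, where \<open>J\<close> agrees with the real function \<open>j\<close>.\<close>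
  define P where "P = dual_cone C"
  define D where "D = U \<inter> effective_domain J"
  define j where "j v = real_of_ereal (J v)" for v
  define F where "F v = G v + j v" for v
  have P: "convex P" "closed P" "cone P"
    by (simp_all add: P_def convex_dual_cone closed_dual_cone cone_dual_cone)
  have J_real: "J v = ereal (j v)" if "v \<in> D" for v
    using that H1(1)[of v] unfolding D_def effective_domain_def j_def by (cases "J v") auto
  have L_real: "L v r = ereal (F v + r \<bullet> \<Theta> v)" if "v \<in> D" for v r
    unfolding L lagrangian_def objective_def F_def J_real[OF that] by simp
  have J_conv: "J (\<alpha> *\<^sub>R x + (1 - \<alpha>) *\<^sub>R y) \<le> ereal (\<alpha> * j x + (1 - \<alpha>) * j y)"
    if "x \<in> D" "y \<in> D" "\<alpha> \<in> {0..1}" for x y \<alpha>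
    using H1(2) that unfolding ereal_convex_def by (metis J_real times_ereal.simps(1) plus_ereal.simps(1))
  have D_conv: "convex D"
    unfolding convex_alt
  proof (intro ballI allI impI)
    fix x y :: "real ^ 'n" and t :: real
    assume xy: "x \<in> D" "y \<in> D" and t: "0 \<le> t \<and> t \<le> 1"
    have "J ((1 - t) *\<^sub>R x + t *\<^sub>R y) < \<infinity>"
      using J_conv[OF xy, of "1 - t"] t by auto
    moreover have "(1 - t) *\<^sub>R x + t *\<^sub>R y \<in> U"
      using U(3) xy t unfolding D_def convex_alt by blast
    ultimately show "(1 - t) *\<^sub>R x + t *\<^sub>R y \<in> D"
      by (simp add: D_def effective_domain_def)
  qed
  have j_conv: "convex_on D j"
  proof (rule convex_onI)
    fix t x y assume t: "0 < t" "t < (1::real)" and xy: "x \<in> D" "y \<in> D"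
    have "(1 - t) *\<^sub>R x + t *\<^sub>R y \<in> D"
      using D_conv xy t unfolding convex_alt by simp
    then show "j ((1 - t) *\<^sub>R x + t *\<^sub>R y) \<le> (1 - t) * j x + t * j y"
      using J_conv[OF xy, of "1 - t"] t by (simp add: J_real)
  qed (rule D_conv)
  have DU: "D \<subseteq> U"
    by (simp add: D_def)
  have q_def: "q k = closest_point P (p k + \<rho> k *\<^sub>R (\<Omega> (u k) + \<Phi> (u k)))"
    and p_Suc: "p (Suc k) = closest_point P (p k + \<rho> k *\<^sub>R (\<Omega> (u (Suc k)) + \<Phi> (u (Suc k))))"
    and argmin: "is_arg_min (\<lambda>v. ereal (gradient G (u k) \<bullet> v) + J v
        + ereal (q k \<bullet> (frechet_derivative \<Omega> (at (u k)) v + \<Phi> v))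
        + ereal ((norm (v - u k))\<^sup>2 / (2 * \<epsilon> k))) (\<lambda>v. v \<in> U) (u (Suc k))" for k
    using alg unfolding vapp_s_def P_def by blast+
  have u_U: "u k \<in> U" for k
    using alg argmin unfolding vapp_s_def is_arg_min_def by (cases k) auto
  have P_ne: "P \<noteq> {}"
    using alg unfolding vapp_s_def P_def by blast
  have q_P: "q k \<in> P" for k
    unfolding q_def by (rule closest_point_in_set[OF P(2) P_ne])
  have p_P: "p k \<in> P" for k
  proof (cases k)
    case 0
    then show ?thesis using alg by (simp add: vapp_s_def P_def)
  next
    case (Suc l)
    then show ?thesis using closest_point_in_set[OF P(2) P_ne] by (simp add: p_Suc)
  qed
  define g where "g k = gradient G (u k) + gradient (\<lambda>v. q k \<bullet> \<Omega> v) (u k)" for k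
  define \<psi> where "\<psi> k v = g k \<bullet> v + (j v + q k \<bullet> \<Phi> v) + (norm (v - u k))\<^sup>2 / (2 * \<epsilon> k)" for k v
  have sub_real: "ereal (gradient G (u k) \<bullet> v) + J v
      + ereal (q k \<bullet> (frechet_derivative \<Omega> (at (u k)) v + \<Phi> v))
      + ereal ((norm (v - u k))\<^sup>2 / (2 * \<epsilon> k)) = ereal (\<psi> k v)" if "v \<in> D" for k v
    unfolding J_real[OF that] inner_add_right GDERIV_inner_compose(2)[OF H4(1)]
    by (simp add: \<psi>_def g_def inner_add_left)
  obtain v0 where v0: "v0 \<in> D"
    using H1(4) by (auto simp: D_def)
  have u_D: "u (Suc k) \<in> D" for k
  proof -
    let ?f = "\<lambda>v. ereal (gradient G (u k) \<bullet> v) + J v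
      + ereal (q k \<bullet> (frechet_derivative \<Omega> (at (u k)) v + \<Phi> v))
      + ereal ((norm (v - u k))\<^sup>2 / (2 * \<epsilon> k))"
    have "\<not> ?f v0 < ?f (u (Suc k))"
      using argmin[of k] v0 DU unfolding is_arg_min_def by blast
    then have "?f (u (Suc k)) \<le> ereal (\<psi> k v0)"
      unfolding sub_real[OF v0] not_less .
    then have "J (u (Suc k)) \<noteq> \<infinity>"
      by auto
    then show ?thesis
      using u_U[of "Suc k"] by (auto simp: D_def effective_domain_def less_top[symmetric])
  qed
  have u_min: "\<psi> k (u (Suc k)) \<le> \<psi> k x" if "x \<in> D" for k x
  proof -
    have "\<not> ereal (\<psi> k x) < ereal (\<psi> k (u (Suc k)))"
      using argmin[of k] that DU unfolding is_arg_min_def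
      unfolding sub_real[OF that, symmetric] sub_real[OF u_D, symmetric] by blast
    then show ?thesis by simp
  qed
  have \<Theta>_lip: "\<tau>-lipschitz_on U \<Theta>"
    using H5(2) lipschitz_on_subset by blast
  have B: "0 \<le> B_G" "0 \<le> B_\<Omega>"
    using H2(3) H4(2) lipschitz_on_nonneg by blast+
  have \<eta>: "0 < \<eta>"
    using H5(1) G_strong(1) by (simp add: eta)
  have c0_ge: "1 \<le> c0"
    using B G_strong(1) by (simp add: c0 add_nonneg_nonneg)
  have \<eta>\<tau>: "\<eta> * \<tau>\<^sup>2 = \<beta>_G / 2"
    using H5(1) by (simp add: eta)
  have \<beta>c0: "\<beta>_G * c0 = 2 * (B_G + B_\<Omega>) + 2 * \<beta>_G"
    using G_strong(1) by (simp add: c0 field_simps)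
  \<comment> \<open>The choice of \<open>c0\<close> makes \<open>1 / \<epsilon> k\<close> a multiple of \<open>c0 + k + 1\<close>, which the telescoping needs.\<close>
  have inv_eps: "1 / \<epsilon> k = \<beta>_G / 2 * (c0 + real k + 1)" for k
  proof -
    have "\<beta>_G / 2 * (c0 + real k + 1) = \<beta>_G * c0 / 2 + (real k + 1) * (\<beta>_G / 2)"
      by (simp add: algebra_simps add_divide_distrib)
    then show ?thesis
      unfolding \<beta>c0 \<eta>\<tau>[symmetric] by (simp add: eps mult.assoc)
  qed
  have G_sc: "strongly_convex_on S G \<beta>_G" for S
    using G_strong(2) by (simp add: strongly_convex_def strongly_convex_on_def)
  have \<Theta>_conv: "convex_on D (\<lambda>v. r \<bullet> \<Theta> v)" if "r \<in> P" for r
  proof -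
    have "convex_on U (\<lambda>v. r \<bullet> \<Omega> v + r \<bullet> \<Phi> v)"
      using that H3 U(3) unfolding P_def
      by (intro convex_on_add cone_convex_on_imp_convex_on_inner)
    then have "convex_on U (\<lambda>v. r \<bullet> \<Theta> v)"
      by (simp add: Theta inner_add_right)
    then show ?thesis
      using convex_on_subset DU D_conv by blast
  qed
  have step: "(F (u (Suc k)) + r \<bullet> \<Theta> (u (Suc k))) - (F v + q k \<bullet> \<Theta> v)
      \<le> \<beta>_G / 4 * (c0 + real k - 1) * (norm (v - u k))\<^sup>2
        - \<beta>_G / 4 * (c0 + real k + 1) * (norm (v - u (Suc k)))\<^sup>2
        - \<beta>_G / 2 * (norm (u (Suc k) - u k))\<^sup>2
        + ((norm (r - p k))\<^sup>2 - (norm (r - p (Suc k)))\<^sup>2 - (norm (q k - p k))\<^sup>2)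
          / (2 * ((real k + 1) * \<eta>))" if v: "v \<in> D" and r: "r \<in> P" for k v r
  proof -
    have \<Phi>q: "convex_on D (\<lambda>v. q k \<bullet> \<Phi> v)" and \<Omega>q: "convex_on U (\<lambda>v. q k \<bullet> \<Omega> v)"
      using cone_convex_on_imp_convex_on_inner[OF _ U(3) q_P[unfolded P_def]] H3
        convex_on_subset DU D_conv by blast+
    have main: "(G (u (Suc k)) + j (u (Suc k)) + r \<bullet> (\<Omega> (u (Suc k)) + \<Phi> (u (Suc k))))
          - (G v + j v + q k \<bullet> (\<Omega> v + \<Phi> v))
        \<le> (1 / (2 * \<epsilon> k) - \<beta>_G / 2) * (norm (v - u k))\<^sup>2
          - 1 / (2 * \<epsilon> k) * (norm (v - u (Suc k)))\<^sup>2
          - (1 / \<epsilon> k - B_G - B_\<Omega> - \<rho> k * \<tau>\<^sup>2) / 2 * (norm (u (Suc k) - u k))\<^sup>2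
          + ((norm (r - p k))\<^sup>2 - (norm (r - p (Suc k)))\<^sup>2 - (norm (q k - p k))\<^sup>2) / (2 * \<rho> k)"
    proof (rule linearized_primal_dual_step[OF D_conv DU u_D v U(3) u_U P(1,2) q_P r j_conv \<Phi>q \<Omega>q G_sc,
          where gG = "gradient G" and g\<Omega> = "gradient (\<lambda>v. q k \<bullet> \<Omega> v)"])
      show "B_G-lipschitz_on U (gradient G)"
        using H2(3) lipschitz_on_subset by blast
      show "\<tau>-lipschitz_on U (\<lambda>v. \<Omega> v + \<Phi> v)"
        using \<Theta>_lip by (simp add: Theta[abs_def])
      show "0 < \<rho> k"
        using \<eta> by (simp add: rho)
    qed (use H2(2) H4 u_min[unfolded \<psi>_def g_def] q_def p_Suc in
        \<open>auto intro: GDERIV_gradient GDERIV_inner_compose(1)\<close>)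
    have e2: "1 / (2 * \<epsilon> k) = \<beta>_G / 4 * (c0 + real k + 1)"
      using inv_eps[of k] by simp
    have c1: "\<beta>_G / 4 * (c0 + real k + 1) - \<beta>_G / 2 = \<beta>_G / 4 * (c0 + real k - 1)"
      by (simp add: algebra_simps)
    \<comment> \<open>The proximal term outweighs all error terms by exactly \<open>\<beta>_G\<close>, the source of summability.\<close>
    have c2: "(1 / \<epsilon> k - B_G - B_\<Omega> - \<rho> k * \<tau>\<^sup>2) / 2 = \<beta>_G / 2"
      by (simp add: eps rho)
    show ?thesis
      using main unfolding e2 c1 c2 by (simp add: F_def Theta rho)
  qed
  interpret R: primal_dual_recursion D P F \<Theta> u p q \<beta>_G \<eta> c0
  proof
    have "strongly_convex_on D (\<lambda>v. G v + j v) (\<beta>_G + 0)"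
      by (intro strongly_convex_on_add G_sc convex_on_imp_strongly_convex_on_0 j_conv)
    then show "strongly_convex_on D F \<beta>_G"
      by (simp add: F_def[abs_def])
  qed (fact D_conv P G_strong(1) \<eta> c0_ge u_D p_P q_P \<Theta>_conv step)+
  have ubar_R: "ubar = R.ubar" and pbar_R: "pbar = R.pbar"
    by (simp_all add: fun_eq_iff ubar pbar R.ubar_def R.pbar_def)
  have sad: "ustar \<in> U" "pstar \<in> P"
    "\<And>v r. v \<in> U \<Longrightarrow> r \<in> P \<Longrightarrow> L ustar r \<le> L ustar pstar \<and> L ustar pstar \<le> L v pstar"
    using saddle unfolding saddle_point_def P_def by auto
  have us_D: "ustar \<in> D"
  proof -
    have "L ustar pstar \<le> ereal (F v0 + pstar \<bullet> \<Theta> v0)"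
      using sad(3)[of v0 pstar] sad(2) v0 DU by (auto simp: L_real)
    then have "J ustar \<noteq> \<infinity>"
      by (auto simp: L lagrangian_def objective_def)
    then show ?thesis
      using sad(1) by (auto simp: D_def effective_domain_def less_top[symmetric])
  qed
  have R_saddle: "R.saddle ustar pstar"
    unfolding R.saddle_def R.Lag_def
  proof (intro conjI ballI us_D sad(2))
    fix v r assume v: "v \<in> D" and r: "r \<in> P"
    then have "L ustar r \<le> L v pstar"
      using sad(3)[of v r] DU by (meson order_trans subsetD)
    then show "F ustar + r \<bullet> \<Theta> ustar \<le> F v + pstar \<bullet> \<Theta> v"
      using v us_D by (simp add: L_real)
  qed
  have lsc: "seq_lsc_at D F ustar"
    unfolding seq_lsc_at_def
  proof (intro allI impI)
    fix X :: "nat \<Rightarrow> real ^ 'n" and c :: "nat \<Rightarrow> real" and l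
    assume X: "\<forall>n. X n \<in> D \<and> F (X n) \<le> c n" "X \<longlonglongrightarrow> ustar" and c: "c \<longlonglongrightarrow> l"
    have "isCont G ustar"
      using H2(2) differentiable_imp_continuous_within by blast
    from isCont_tendsto_compose[OF this X(2)]
    have "(\<lambda>n. c n - G (X n)) \<longlonglongrightarrow> l - G ustar"
      by (rule tendsto_diff[OF c])
    moreover have "J (X n) \<le> ereal (c n - G (X n))" for n
      using X(1)[rule_format, of n] by (simp add: J_real F_def)
    ultimately have "J ustar \<le> ereal (l - G ustar)"
      by (rule lsc_le_of_tendsto[OF H1(3) X(2)])
    then show "F ustar \<le> l"
      using us_D by (simp add: J_real F_def)
  qed
  have \<Theta>_cont: "continuous_on D \<Theta>"
    using lipschitz_on_continuous_on[OF \<Theta>_lip] DU by (rule continuous_on_subset)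
  have i: "(\<lambda>t. (norm (ustar - u t))\<^sup>2) \<in> o(\<lambda>t. 1 / (real t)\<^sup>2)"
    by (rule R.primal_smallo[OF R_saddle lsc \<Theta>_cont])
  have ii: "L (ubar t) r - L v (pbar t)
      \<le> ereal ((2 * a 0 * (norm (v - u 0))\<^sup>2 + 2 * b 0 * (norm (r - p 0))\<^sup>2)
            / ((real t + 1) * (real t + 2 * c0)))" if v: "v \<in> U" and r: "r \<in> P" for t v r
  proof (cases "v \<in> D")
    case True
    have e0: "1 / (2 * \<epsilon> 0) = \<beta>_G / 4 * (c0 + 1)"
      using inv_eps[of 0] by simp
    have a0: "a 0 = \<beta>_G / 4 * (c0 * (c0 - 1))"
      unfolding a e0 by (simp add: algebra_simps)
    have b0: "b 0 = c0 / (2 * \<eta>)"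
      by (simp add: b rho)
    have "2 * a 0 * (norm (v - u 0))\<^sup>2 + 2 * b 0 * (norm (r - p 0))\<^sup>2 = 2 * R.energy v r 0"
      unfolding a0 b0 by (simp add: R.energy_def)
    moreover have "L (ubar t) r - L v (pbar t) = ereal (R.Lag (ubar t) r - R.Lag v (pbar t))"
      using True R.ubar_in by (simp add: L_real R.Lag_def ubar_R)
    ultimately show ?thesis
      using R.ergodic_gap[OF True r, of t] by (simp add: ubar_R pbar_R)
  next
    \<comment> \<open>Outside the domain of \<open>J\<close> the left-hand side is \<open>-\<infinity>\<close>.\<close>
    case False
    then have "J v = \<infinity>"
      using v by (simp add: D_def effective_domain_def)
    then have "L v (pbar t) = \<infinity>"
      by (simp add: L lagrangian_def objective_def)
    then show ?thesis
      using R.ubar_in[of t] by (simp add: L_real ubar_R)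
  qed
  have iii: "\<exists>c>0. \<forall>t\<ge>1. norm (closest_point P (\<Theta> (ubar t))) \<le> c / (real t)\<^sup>2"
    unfolding ubar_R by (rule R.ergodic_feasibility[OF R_saddle])
  have "objective G J v = ereal (F v)" if "v \<in> D" for v
    by (simp add: objective_def F_def J_real[OF that])
  then have iv: "\<exists>c>0. \<forall>t\<ge>1. \<bar>objective G J (ubar t) - objective G J ustar\<bar> \<le> ereal (c / (real t)\<^sup>2)"
    using R.ergodic_objective[OF R_saddle] R.ubar_in us_D by (simp add: ubar_R)
  show ?thesis
    using i ii iii iv unfolding P_def by blast
qed

end
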